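(* Let $(\eta(t),\omega_1(t),\omega_2(t),\omega_3(t))$, $t\in I=(a,b)$, be a (smooth) family of $\mathrm{SU}(2)$-structures on a 5-manifold $N$. Then the $\mathrm{SU}(3)$-structure on $M=N\times I$ given by $$F=\omega_3(t)+\eta(t)\wedge dt,\qquad \Psi=(\omega_1(t)+i\,\omega_2(t))\wedge(\eta(t)+i\,dt)$$ is balanced Hermitian (i.e. $F\wedge F$ and $\Psi$ are closed on $M$) if and only if $(\eta(t),\omega_1(t),\omega_2(t),\omega_3(t))$ is a balanced $\mathrm{SU}(2)$-structure on $N$ for every $t\in I$ and the following evolution equations are satisfied: $$\partial_t(\omega_1\wedge\eta)=-d\omega_2,\qquad \partial_t(\omega_2\wedge\eta)=d\omega_1,\qquad \partial_t(\omega_3\wedge\omega_3)=-2\,d(\omega_3\wedge\eta),$$ where $d$ denotes the exterior derivative on $N$.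
   Context: An $\mathrm{SU}(2)$-structure on a 5-manifold $N$ is a quadruplet $(\eta,\omega_1,\omega_2,\omega_3)$, where $\eta$ is a 1-form and the $\omega_i$ are 2-forms such that $\omega_i\wedge\omega_j=\delta_{ij}v$ for some 4-form $v$ with $v\wedge\eta$ nowhere zero, and such that $i_X\omega_3=i_Y\omega_1$ implies $\omega_2(X,Y)\ge0$ (here $i_X$ is contraction by $X$). It is called balanced if $d(\omega_1\wedge\eta)=d(\omega_2\wedge\eta)=d(\omega_3\wedge\omega_3)=0$. An $\mathrm{SU}(3)$-structure on a 6-manifold is given by a 2-form $F$ and a complex 3-form $\Psi=\Psi_++i\Psi_-$ for which locally there is a basis of 1-forms $e^1,\dots,e^6$ with $F=e^{12}+e^{34}+e^{56}$ and $\Psi=(e^1+ie^2)\wedge(e^3+ie^4)\wedge(e^5+ie^6)$, where $e^{ij}=e^i\wedge e^j$. It is balanced (balanced Hermitian) if $d(F\wedge F)=0$ and $d\Psi_+=d\Psi_-=0$ (closedness of $\Psi$ implies that the underlying almost complex structure is integrable). *)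

theory Defs
  imports "HOL-Analysis.Analysis" "HOL-Combinatorics.Combinatorics"
begin

section \<open>Smooth maps between Euclidean spaces\<close>

text \<open>In finite dimension, a function is of class \<open>C\<^sup>n\<^sup>+\<^sup>1\<close> on an open set iff it is differentiable there
  and each of its directional derivatives is of class \<open>C\<^sup>n\<close>.\<close>

primrec C_k_on :: "nat \<Rightarrow> 'v::euclidean_space set \<Rightarrow> ('v \<Rightarrow> 'w::real_normed_vector) \<Rightarrow> bool" where
  "C_k_on 0 S f \<longleftrightarrow> continuous_on S f"
| "C_k_on (Suc n) S f \<longleftrightarrow>
     (\<forall>x\<in>S. f differentiable (at x)) \<and> (\<forall>h. C_k_on n S (\<lambda>x. frechet_derivative f (at x) h))"

definition smooth_on :: "'v::euclidean_space set \<Rightarrow> ('v \<Rightarrow> 'w::real_normed_vector) \<Rightarrow> bool" where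
  "smooth_on S f \<longleftrightarrow> (\<forall>n. C_k_on n S f)"


section \<open>Smooth manifolds\<close>

text \<open>A manifold without boundary modelled on \<open>'v\<close> (so of dimension \<open>DIM('v)\<close>) is a topological
  space with an indexed smooth atlas \<open>(patch c, coord c)\<close>, \<open>c \<in> charts\<close>.  The atlas need not be
  maximal: only the smooth structure it generates matters.  Values of \<open>coord c\<close> outside \<open>patch c\<close>
  are irrelevant.\<close>

record ('i, 'a, 'v) atlas =
  points :: "'a topology"
  charts :: "'i set"
  patch :: "'i \<Rightarrow> 'a set"
  coord :: "'i \<Rightarrow> 'a \<Rightarrow> 'v"

definition coord_range :: "('i, 'a, 'v) atlas \<Rightarrow> 'i \<Rightarrow> 'v set" where
  "coord_range M c = coord M c ` patch M c"

definition overlap :: "('i, 'a, 'v) atlas \<Rightarrow> 'i \<Rightarrow> 'i \<Rightarrow> 'v set" where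
  "overlap M c c' = coord M c ` (patch M c \<inter> patch M c')"

definition transition :: "('i, 'a, 'v) atlas \<Rightarrow> 'i \<Rightarrow> 'i \<Rightarrow> 'v \<Rightarrow> 'v" where
  "transition M c c' = coord M c' \<circ> inv_into (patch M c) (coord M c)"

definition smooth_manifold :: "('i, 'a, 'v::euclidean_space) atlas \<Rightarrow> bool" where
  "smooth_manifold M \<longleftrightarrow>
     Hausdorff_space (points M) \<and>
     (\<exists>\<B>. countable \<B> \<and> (\<forall>B\<in>\<B>. openin (points M) B) \<and>
        (\<forall>U x. openin (points M) U \<and> x \<in> U \<longrightarrow> (\<exists>B\<in>\<B>. x \<in> B \<and> B \<subseteq> U))) \<and>
     (\<Union>c\<in>charts M. patch M c) = topspace (points M) \<and>
     (\<forall>c\<in>charts M. openin (points M) (patch M c) \<and> open (coord_range M c) \<and>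
        homeomorphic_map (subtopology (points M) (patch M c)) (top_of_set (coord_range M c))
          (coord M c)) \<and>
     (\<forall>c\<in>charts M. \<forall>c'\<in>charts M. smooth_on (overlap M c c') (transition M c c'))"

definition times_interval ::
    "('i, 'a, 'v) atlas \<Rightarrow> real set \<Rightarrow> ('i, 'a \<times> real, 'v \<times> real) atlas" where
  "times_interval N I =
     \<lparr>points = prod_topology (points N) (top_of_set I),
      charts = charts N,
      patch = (\<lambda>c. patch N c \<times> I),
      coord = (\<lambda>c (p, t). (coord N c p, t))\<rparr>"


section \<open>Alternating forms on a vector space\<close>

text \<open>A \<open>k\<close>-form takes a sequence of vectors, of which only those with index \<open>< k\<close> matter.  Its values
  are in \<open>'b\<close>, that is in \<open>real\<close> or \<open>complex\<close>; it is real multilinear in both cases.\<close>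

type_synonym ('v, 'b) covector = "(nat \<Rightarrow> 'v) \<Rightarrow> 'b"

definition alt_form :: "nat \<Rightarrow> ('v::real_vector, 'b::real_vector) covector \<Rightarrow> bool" where
  "alt_form k f \<longleftrightarrow>
     (\<forall>v w. (\<forall>i<k. v i = w i) \<longrightarrow> f v = f w) \<and>
     (\<forall>i<k. \<forall>v. linear (\<lambda>x. f (v(i := x)))) \<and>
     (\<forall>v. \<forall>i<k. \<forall>j<k. i \<noteq> j \<and> v i = v j \<longrightarrow> f v = 0)"

text \<open>The normalisation is the one with \<open>(\<alpha> \<and> \<beta>)(X, Y) = \<alpha>(X) \<beta>(Y) - \<alpha>(Y) \<beta>(X)\<close> for 1-forms.\<close>

definition alt_wedge ::
    "nat \<Rightarrow> nat \<Rightarrow> ('v, 'b::real_normed_field) covector \<Rightarrow> ('v, 'b) covector \<Rightarrow> ('v, 'b) covector" where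
  "alt_wedge k l f g = (\<lambda>v.
     (\<Sum>\<sigma> | \<sigma> permutes {..<k + l}. of_int (sign \<sigma>) * f (v \<circ> \<sigma>) * g (\<lambda>i. v (\<sigma> (k + i))))
       / (fact k * fact l))"

definition contract :: "'v \<Rightarrow> ('v, 'b) covector \<Rightarrow> ('v, 'b) covector" where
  "contract X f = (\<lambda>v. f (case_nat X v))"


section \<open>Differential forms\<close>

text \<open>A differential form is a family of forms on the coordinate ranges, one for each chart, that are
  related by pullback along the transition maps.\<close>

type_synonym ('i, 'v, 'b) dform = "'i \<Rightarrow> 'v \<Rightarrow> ('v, 'b) covector"

definition smooth_form_on ::
    "'v::euclidean_space set \<Rightarrow> nat \<Rightarrow> ('v \<Rightarrow> ('v, 'b::real_normed_vector) covector) \<Rightarrow> bool" where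
  "smooth_form_on S k \<alpha> \<longleftrightarrow> (\<forall>x\<in>S. alt_form k (\<alpha> x)) \<and> (\<forall>v. smooth_on S (\<lambda>x. \<alpha> x v))"

definition pullback ::
    "('v::real_normed_vector \<Rightarrow> 'w::real_normed_vector) \<Rightarrow> ('w \<Rightarrow> ('w, 'b) covector) \<Rightarrow> 'v \<Rightarrow> ('v, 'b) covector" where
  "pullback \<phi> \<alpha> = (\<lambda>x v. \<alpha> (\<phi> x) (\<lambda>i. frechet_derivative \<phi> (at x) (v i)))"

definition diff_form ::
    "('i, 'a, 'v::euclidean_space) atlas \<Rightarrow> nat \<Rightarrow> ('i, 'v, 'b::real_normed_vector) dform \<Rightarrow> bool" where
  "diff_form M k \<alpha> \<longleftrightarrow>
     (\<forall>c\<in>charts M. smooth_form_on (coord_range M c) k (\<alpha> c)) \<and>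
     (\<forall>c\<in>charts M. \<forall>c'\<in>charts M. \<forall>x\<in>overlap M c c'.
        \<alpha> c x = pullback (transition M c c') (\<alpha> c') x)"

definition form_eq :: "('i, 'a, 'v) atlas \<Rightarrow> ('i, 'v, 'b) dform \<Rightarrow> ('i, 'v, 'b) dform \<Rightarrow> bool" where
  "form_eq M \<alpha> \<beta> \<longleftrightarrow> (\<forall>c\<in>charts M. \<forall>x\<in>coord_range M c. \<alpha> c x = \<beta> c x)"

definition wedge ::
    "nat \<Rightarrow> nat \<Rightarrow> ('i, 'v, 'b::real_normed_field) dform \<Rightarrow> ('i, 'v, 'b) dform \<Rightarrow> ('i, 'v, 'b) dform" where
  "wedge k l \<alpha> \<beta> = (\<lambda>c x. alt_wedge k l (\<alpha> c x) (\<beta> c x))"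

text \<open>\<open>(d\<alpha>)(v\<^sub>0, \<dots>, v\<^sub>k) = \<Sum>\<^sub>i (-1)\<^sup>i (D\<^sub>v\<^sub>i \<alpha>)(v\<^sub>0, \<dots>, v\<^sub>i\<^sub>-\<^sub>1, v\<^sub>i\<^sub>+\<^sub>1, \<dots>, v\<^sub>k)\<close> for constant vectors \<open>v\<^sub>i\<close>,
  which is \<open>d(f dx\<^sup>J) = df \<and> dx\<^sup>J\<close> in coordinates.\<close>

definition ext_d :: "nat \<Rightarrow> ('i, 'v::euclidean_space, 'b::real_normed_field) dform \<Rightarrow> ('i, 'v, 'b) dform" where
  "ext_d k \<alpha> = (\<lambda>c x v.
     \<Sum>i\<le>k. (-1) ^ i *
       frechet_derivative (\<lambda>y. \<alpha> c y (\<lambda>j. if j < i then v j else v (Suc j))) (at x) (v i))"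

definition closed_form ::
    "('i, 'a, 'v::euclidean_space) atlas \<Rightarrow> nat \<Rightarrow> ('i, 'v, 'b::real_normed_field) dform \<Rightarrow> bool" where
  "closed_form M k \<alpha> \<longleftrightarrow> form_eq M (ext_d k \<alpha>) (\<lambda>c x v. 0)"

definition complex_form :: "('i, 'v, real) dform \<Rightarrow> ('i, 'v, real) dform \<Rightarrow> ('i, 'v, complex) dform" where
  "complex_form \<alpha> \<beta> = (\<lambda>c x v. complex_of_real (\<alpha> c x v) + \<i> * complex_of_real (\<beta> c x v))"

definition Re_form :: "('i, 'v, complex) dform \<Rightarrow> ('i, 'v, real) dform" where
  "Re_form \<Psi> = (\<lambda>c x v. Re (\<Psi> c x v))"

definition Im_form :: "('i, 'v, complex) dform \<Rightarrow> ('i, 'v, real) dform" where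
  "Im_form \<Psi> = (\<lambda>c x v. Im (\<Psi> c x v))"


section \<open>SU(2)-structures on 5-manifolds\<close>

definition SU2_structure ::
    "('i, 'a, 'v::euclidean_space) atlas \<Rightarrow> ('i, 'v, real) dform \<Rightarrow>
     ('i, 'v, real) dform \<Rightarrow> ('i, 'v, real) dform \<Rightarrow> ('i, 'v, real) dform \<Rightarrow> bool" where
  "SU2_structure N \<eta> \<omega>1 \<omega>2 \<omega>3 \<longleftrightarrow>
     smooth_manifold N \<and> DIM('v) = 5 \<and>
     diff_form N 1 \<eta> \<and> diff_form N 2 \<omega>1 \<and> diff_form N 2 \<omega>2 \<and> diff_form N 2 \<omega>3 \<and>
     (\<exists>\<nu>. diff_form N 4 \<nu> \<and>
        (\<forall>i<3. \<forall>j<3. form_eq N (wedge 2 2 ([\<omega>1, \<omega>2, \<omega>3] ! i) ([\<omega>1, \<omega>2, \<omega>3] ! j))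
                              (if i = j then \<nu> else (\<lambda>c x v. 0))) \<and>
        (\<forall>c\<in>charts N. \<forall>x\<in>coord_range N c. wedge 4 1 \<nu> \<eta> c x \<noteq> (\<lambda>v. 0))) \<and>
     (\<forall>c\<in>charts N. \<forall>x\<in>coord_range N c. \<forall>X Y.
        contract X (\<omega>3 c x) = contract Y (\<omega>1 c x) \<longrightarrow> \<omega>2 c x (case_nat X (\<lambda>_. Y)) \<ge> 0)"

definition balanced_SU2_structure ::
    "('i, 'a, 'v::euclidean_space) atlas \<Rightarrow> ('i, 'v, real) dform \<Rightarrow>
     ('i, 'v, real) dform \<Rightarrow> ('i, 'v, real) dform \<Rightarrow> ('i, 'v, real) dform \<Rightarrow> bool" where
  "balanced_SU2_structure N \<eta> \<omega>1 \<omega>2 \<omega>3 \<longleftrightarrow>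
     SU2_structure N \<eta> \<omega>1 \<omega>2 \<omega>3 \<and>
     closed_form N 3 (wedge 2 1 \<omega>1 \<eta>) \<and>
     closed_form N 3 (wedge 2 1 \<omega>2 \<eta>) \<and>
     closed_form N 4 (wedge 2 2 \<omega>3 \<omega>3)"


section \<open>SU(3)-structures on 6-manifolds\<close>

definition one_form_basis :: "nat set \<Rightarrow> (nat \<Rightarrow> ('v::real_vector, real) covector) \<Rightarrow> bool" where
  "one_form_basis J e \<longleftrightarrow>
     (\<forall>i\<in>J. alt_form 1 (e i)) \<and>
     (\<forall>a. (\<forall>v. (\<Sum>i\<in>J. a i * e i v) = 0) \<longrightarrow> (\<forall>i\<in>J. a i = 0)) \<and>
     (\<forall>f. alt_form 1 f \<longrightarrow> (\<exists>a. \<forall>v. f v = (\<Sum>i\<in>J. a i * e i v)))"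

definition SU3_model_F :: "(nat \<Rightarrow> ('v, real) covector) \<Rightarrow> ('v, real) covector" where
  "SU3_model_F e = (\<lambda>v. alt_wedge 1 1 (e 1) (e 2) v + alt_wedge 1 1 (e 3) (e 4) v
                          + alt_wedge 1 1 (e 5) (e 6) v)"

definition SU3_model_Psi :: "(nat \<Rightarrow> ('v, real) covector) \<Rightarrow> ('v, complex) covector" where
  "SU3_model_Psi e =
     (let z = (\<lambda>i j v. complex_of_real (e i v) + \<i> * complex_of_real (e j v))
      in alt_wedge 2 1 (alt_wedge 1 1 (z 1 2) (z 3 4)) (z 5 6))"

definition SU3_structure ::
    "('i, 'a, 'v::euclidean_space) atlas \<Rightarrow> ('i, 'v, real) dform \<Rightarrow> ('i, 'v, complex) dform \<Rightarrow> bool" where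
  "SU3_structure M F \<Psi> \<longleftrightarrow>
     smooth_manifold M \<and> DIM('v) = 6 \<and> diff_form M 2 F \<and> diff_form M 3 \<Psi> \<and>
     (\<forall>c\<in>charts M. \<forall>x\<in>coord_range M c.
        \<exists>W e. open W \<and> x \<in> W \<and> W \<subseteq> coord_range M c \<and>
          (\<forall>i\<in>{1..6}. smooth_form_on W 1 (e i)) \<and>
          (\<forall>y\<in>W. one_form_basis {1..6} (\<lambda>i. e i y) \<and>
             F c y = SU3_model_F (\<lambda>i. e i y) \<and> \<Psi> c y = SU3_model_Psi (\<lambda>i. e i y)))"

definition balanced_SU3_structure ::
    "('i, 'a, 'v::euclidean_space) atlas \<Rightarrow> ('i, 'v, real) dform \<Rightarrow> ('i, 'v, complex) dform \<Rightarrow> bool" where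
  "balanced_SU3_structure M F \<Psi> \<longleftrightarrow>
     SU3_structure M F \<Psi> \<and>
     closed_form M 4 (wedge 2 2 F F) \<and>
     closed_form M 3 (Re_form \<Psi>) \<and> closed_form M 3 (Im_form \<Psi>)"


section \<open>Families of forms and forms on the product with an interval\<close>

definition smooth_family ::
    "('i, 'a, 'v::euclidean_space) atlas \<Rightarrow> real set \<Rightarrow> nat \<Rightarrow> (real \<Rightarrow> ('i, 'v, real) dform) \<Rightarrow> bool" where
  "smooth_family N I k \<alpha> \<longleftrightarrow>
     (\<forall>t\<in>I. diff_form N k (\<alpha> t)) \<and>
     (\<forall>c\<in>charts N. \<forall>v. smooth_on (coord_range N c \<times> I) (\<lambda>(x, t). \<alpha> t c x v))"

definition time_deriv :: "(real \<Rightarrow> ('i, 'v, real) dform) \<Rightarrow> real \<Rightarrow> ('i, 'v, real) dform" where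
  "time_deriv \<alpha> t = (\<lambda>c x v. vector_derivative (\<lambda>s. \<alpha> s c x v) (at t))"

text \<open>\<open>\<alpha>(t)\<close> regarded as a form on \<open>N \<times> I\<close>: at a point \<open>(p, t)\<close> it is the pullback of \<open>\<alpha>(t)\<close> along the
  projection to \<open>N\<close>.\<close>

definition on_product :: "(real \<Rightarrow> ('i, 'v, real) dform) \<Rightarrow> ('i, 'v \<times> real, real) dform" where
  "on_product \<alpha> = (\<lambda>c (x, t) v. \<alpha> t c x (\<lambda>i. fst (v i)))"

definition dt :: "('i, 'v \<times> real, real) dform" where
  "dt = (\<lambda>c z v. snd (v 0))"

definition product_F ::
    "(real \<Rightarrow> ('i, 'v, real) dform) \<Rightarrow> (real \<Rightarrow> ('i, 'v, real) dform) \<Rightarrow> ('i, 'v \<times> real, real) dform" where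
  "product_F \<eta> \<omega>3 = (\<lambda>c z v. on_product \<omega>3 c z v + wedge 1 1 (on_product \<eta>) dt c z v)"

definition product_Psi ::
    "(real \<Rightarrow> ('i, 'v, real) dform) \<Rightarrow> (real \<Rightarrow> ('i, 'v, real) dform) \<Rightarrow>
     (real \<Rightarrow> ('i, 'v, real) dform) \<Rightarrow> ('i, 'v \<times> real, complex) dform" where
  "product_Psi \<eta> \<omega>1 \<omega>2 =
     wedge 2 1 (complex_form (on_product \<omega>1) (on_product \<omega>2)) (complex_form (on_product \<eta>) dt)"

end

theory Submission
  imports Defs
begin

text \<open>On \<open>N \<times> I\<close>, a form \<open>A + B \<and> dt\<close> with \<open>A\<close> of degree \<open>k\<close> has exterior derivative \<open>d\<^sub>NA + (d\<^sub>NB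
  + (-1)\<^sup>k \<partial>\<^sub>tA) \<and> dt\<close>, so it is closed iff \<open>A\<close> is closed for each \<open>t\<close> and \<open>\<partial>\<^sub>tA = (-1)\<^sup>k\<^sup>+\<^sup>1
  d\<^sub>NB\<close>. The equivalence follows from \<open>Re \<Psi> = \<omega>\<^sub>1 \<and> \<eta> - \<omega>\<^sub>2 \<and> dt\<close>, \<open>Im \<Psi> = \<omega>\<^sub>2 \<and> \<eta> + \<omega>\<^sub>1 \<and> dt\<close> and
  \<open>F \<and> F = \<omega>\<^sub>3 \<and> \<omega>\<^sub>3 + 2 \<omega>\<^sub>3 \<and> \<eta> \<and> dt\<close>.

  For the local coframe, fix a constant vector \<open>X\<close> that is not annihilated by the \<open>\<omega>\<^sub>i\<close>. At each
  point the 1-forms \<open>i\<^sub>X\<omega>\<^sub>i\<close> and the 1-form \<open>f\<close> metrically dual to \<open>X\<close>, normalised by \<open>f(X) = 1\<close>,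
  bring the \<open>\<omega>\<^sub>i\<close> to the standard form up to one scalar \<open>\<lambda>\<close>, which is positive by the sign
  condition. Both \<open>f\<close> and \<open>\<lambda>\<close> are rational expressions in the values of the \<open>\<omega>\<^sub>i\<close> on constant
  vectors, so they depend smoothly on the point.\<close>

section \<open>Smooth maps\<close>

text \<open>The delicate point is that the coframe has to be smooth on a neighbourhood in
  \<open>N \<times> I\<close>, while the linear algebra at a point uses vectors that are only known
  to exist: a common kernel vector of the 2-forms, and vectors dual to their contractions with X.
  Nothing makes these choices smooth. Hence the coframe is defined by closed formulas in the values
  of the forms on four vectors that are fixed once for a neighbourhood, and the chosen vectors serve
  only to check, one point at a time, that the formulas give a basis of the right shape.

  In the metric induced by the \<omega>'s, \<lambda> is 1/|X|^2. The contractions of X have length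
  |X|, so they become unit covectors after multiplication by the square root of \<lambda>. This is
  where its positivity is used, and why square roots of smooth functions are treated below.\<close>

lemma C_k_on_subset: "C_k_on n S f \<Longrightarrow> T \<subseteq> S \<Longrightarrow> C_k_on n T f"
  by (induction n arbitrary: f) (auto intro: continuous_on_subset)

lemma has_derivative_cong_open:
  assumes "open S" "x \<in> S" "\<And>y. y \<in> S \<Longrightarrow> f y = g y"
  shows "(f has_derivative D) (at x) \<longleftrightarrow> (g has_derivative D) (at x)"
  using has_derivative_transform_within_open[OF _ assms(1,2), of f D UNIV g]
    has_derivative_transform_within_open[OF _ assms(1,2), of g D UNIV f] assms(3) by auto

lemma frechet_derivative_cong_open:
  assumes "open S" "x \<in> S" "\<And>y. y \<in> S \<Longrightarrow> f y = g y"
  shows "frechet_derivative f (at x) = frechet_derivative g (at x)"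
  unfolding frechet_derivative_def using has_derivative_cong_open[OF assms] by simp

lemma C_k_on_cong:
  assumes "open S" "\<And>x. x \<in> S \<Longrightarrow> f x = g x" "C_k_on n S f"
  shows "C_k_on n S g"
  using assms(2,3)
proof (induction n arbitrary: f g)
  case 0
  then show ?case using continuous_on_cong[OF refl, of S f g] by (simp only: C_k_on.simps)
next
  case (Suc n)
  have d: "g differentiable (at x)" "frechet_derivative g (at x) = frechet_derivative f (at x)"
    if "x \<in> S" for x
  proof -
    note cong = has_derivative_cong_open[OF assms(1) that, of f g]
      frechet_derivative_cong_open[OF assms(1) that, of f g]
    have "f differentiable (at x)" using Suc.prems(2) that by simp
    then show "g differentiable (at x)"
      using cong(1) Suc.prems(1) unfolding differentiable_def by blast
    show "frechet_derivative g (at x) = frechet_derivative f (at x)"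
      using cong(2) Suc.prems(1) by simp
  qed
  have "C_k_on n S (\<lambda>x. frechet_derivative g (at x) h)" for h
    by (rule Suc.IH[of "\<lambda>x. frechet_derivative f (at x) h"]) (use d Suc.prems(2) in simp_all)
  then show ?case using d(1) by simp
qed

text \<open>As \<open>S\<close> is open, any formula \<open>D\<close> that is valid on
  \<open>S\<close> can stand in for \<open>frechet_derivative\<close>, so the inductions below work
  with explicit derivatives.\<close>

lemma C_k_on_SucI:
  assumes "open S" "\<And>x. x \<in> S \<Longrightarrow> (f has_derivative D x) (at x)" "\<And>h. C_k_on n S (\<lambda>x. D x h)"
  shows "C_k_on (Suc n) S f"
proof -
  have "C_k_on n S (\<lambda>x. frechet_derivative f (at x) h)" for h
    by (rule C_k_on_cong[OF assms(1) _ assms(3)[of h]])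
      (use frechet_derivative_at[OF assms(2)] in simp)
  moreover have "f differentiable (at x)" if "x \<in> S" for x
    using assms(2)[OF that] differentiable_def by blast
  ultimately show ?thesis by simp
qed

lemma C_k_on_SucD:
  assumes "C_k_on (Suc n) S f"
  shows "\<And>x. x \<in> S \<Longrightarrow> (f has_derivative frechet_derivative f (at x)) (at x)"
    and "\<And>h. C_k_on n S (\<lambda>x. frechet_derivative f (at x) h)"
  using assms frechet_derivative_works by auto

lemma C_k_on_Suc_imp: "C_k_on (Suc n) S f \<Longrightarrow> C_k_on n S f"
proof (induction n arbitrary: f)
  case 0
  then have "\<forall>x\<in>S. isCont f x"
    using differentiable_imp_continuous_within by (simp only: C_k_on.simps) blast
  then show ?case by (simp add: continuous_at_imp_continuous_on)
next
  case (Suc n)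
  show ?case
    unfolding C_k_on.simps(2)[of n]
    using C_k_on_SucD(2)[OF Suc.prems] Suc.prems Suc.IH by
      (simp only: C_k_on.simps(2)[of "Suc n"] simp_thms)
qed

lemma C_k_on_const: "C_k_on n S (\<lambda>x. c)"
  by (induction n arbitrary: c) simp_all

lemma C_k_on_add:
  assumes "open S" "C_k_on n S f" "C_k_on n S g"
  shows "C_k_on n S (\<lambda>x. f x + g x)"
  using assms(2,3)
proof (induction n arbitrary: f g)
  case 0
  then show ?case by (auto intro: continuous_intros)
next
  case (Suc n)
  note f = C_k_on_SucD[OF Suc.prems(1)] and g = C_k_on_SucD[OF Suc.prems(2)]
  show ?case
    by (rule C_k_on_SucI[OF assms(1) has_derivative_add[OF f(1) g(1)] Suc.IH[OF f(2) g(2)]])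
qed

text \<open>The Leibniz rule multiplies a derivative of one factor by the other factor itself, so
  each factor is also needed in the lower class, by \<open>C_k_on_Suc_imp\<close>.\<close>

lemma C_k_on_mult:
  fixes f g :: "'v::euclidean_space \<Rightarrow> 'b::real_normed_algebra"
  assumes "open S" "C_k_on n S f" "C_k_on n S g"
  shows "C_k_on n S (\<lambda>x. f x * g x)"
  using assms(2,3)
proof (induction n arbitrary: f g)
  case 0
  then show ?case by (auto intro: continuous_intros)
next
  case (Suc n)
  note f = C_k_on_SucD[OF Suc.prems(1)] and g = C_k_on_SucD[OF Suc.prems(2)]
  show ?case
  proof (rule C_k_on_SucI[OF assms(1)])
    show "((\<lambda>x. f x * g x) has_derivative
        (\<lambda>h. f x * frechet_derivative g (at x) h + frechet_derivative f (at x) h * g x)) (at x)"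
      if "x \<in> S" for x
      using has_derivative_mult[OF f(1)[OF that] g(1)[OF that]] .
    show "C_k_on n S (\<lambda>x. f x * frechet_derivative g (at x) h
      + frechet_derivative f (at x) h * g x)" for h
      using C_k_on_Suc_imp[OF Suc.prems(1)] C_k_on_Suc_imp[OF Suc.prems(2)]
      by (intro C_k_on_add[OF assms(1)] Suc.IH f(2) g(2))
  qed
qed

lemma C_k_on_linear_comp:
  assumes "open S" "bounded_linear L" "C_k_on n S f"
  shows "C_k_on n S (\<lambda>x. L (f x))"
  using assms(3)
proof (induction n arbitrary: f)
  case 0
  then show ?case using assms(2) by (auto intro: bounded_linear.continuous_on)
next
  case (Suc n)
  show ?case
    by (rule C_k_on_SucI[OF assms(1) bounded_linear.has_derivative[OF assms(2) C_k_on_SucD(1)[OF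
      Suc.prems]]])
      (assumption, rule Suc.IH[OF C_k_on_SucD(2)[OF Suc.prems]])
qed

text \<open>The derivative of the composite in direction \<open>h\<close> is the derivative of
  \<open>f\<close> in the constant direction \<open>L h\<close>, again composed with
  \<open>L\<close>. The induction closes without a product rule.\<close>

lemma C_k_on_comp_linear:
  fixes L :: "'u::euclidean_space \<Rightarrow> 'v::euclidean_space"
  assumes "open S" "bounded_linear L" "L ` S \<subseteq> T" "C_k_on n T f"
  shows "C_k_on n S (\<lambda>x. f (L x))"
  using assms(4)
proof (induction n arbitrary: f)
  case 0
  then show ?case
    using assms(2,3) continuous_on_compose2[of T f S L] linear_continuous_on by auto
next
  case (Suc n)
  note f = C_k_on_SucD[OF Suc.prems]
  show ?case
  proof (rule C_k_on_SucI[OF assms(1)])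
    show "((\<lambda>x. f (L x)) has_derivative (\<lambda>h. frechet_derivative f (at (L x)) (L h))) (at x)"
      if "x \<in> S" for x
      by (rule has_derivative_compose[OF bounded_linear_imp_has_derivative[OF assms(2)] f(1)])
        (use assms(3) that in auto)
  qed (rule Suc.IH[OF f(2)])
qed

text \<open>The derivative of \<open>r = 1 / sqrt f\<close> is \<open>-1/2 * f' * r^3\<close>, a
  polynomial in \<open>r\<close> and \<open>f'\<close>, so the induction involves no further
  function. Both \<open>1 / f = r * r\<close> and \<open>sqrt f = f * r\<close> then come for
  free.\<close>

lemma C_k_on_rsqrt:
  assumes "open S" "C_k_on n S f" "\<And>x. x \<in> S \<Longrightarrow> f x > 0"
  shows "C_k_on n S (\<lambda>x. 1 / sqrt (f x))"
  using assms(2)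
proof (induction n)
  case 0
  have "sqrt (f x) \<noteq> 0" if "x \<in> S" for x using assms(3)[OF that] by simp
  with 0 show ?case by (auto intro!: continuous_on_divide continuous_on_real_sqrt continuous_on_const)
next
  case (Suc n)
  note f = C_k_on_SucD[OF Suc.prems]
  let ?r = "\<lambda>x. 1 / sqrt (f x)"
  show ?case
  proof (rule C_k_on_SucI[OF assms(1)])
    show "(?r has_derivative (\<lambda>h. (-1/2) * (frechet_derivative f (at x) h * (?r x * (?r x * ?r
      x))))) (at x)"
      if "x \<in> S" for x
    proof -
      let ?g = "\<lambda>y::real. 1 / sqrt y"
      have *: "(?g has_real_derivative - (inverse (sqrt (f x)) / 2) / (sqrt (f x))\<^sup>2) (at (f x))"
        using assms(3)[OF that] DERIV_divide[OF DERIV_const[of 1] DERIV_real_sqrt[of "f x"]]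
        by (simp add: power2_eq_square)
      have "sqrt (f x) \<noteq> 0" using assms(3)[OF that] by simp
      have "- (inverse s / 2) / s\<^sup>2 = (-1/2) * (1 / s * (1 / s * (1 / s)))" if "s \<noteq> 0" for s :: real
        using that by (simp add: field_simps power2_eq_square)
      note eq = this[OF \<open>sqrt (f x) \<noteq> 0\<close>]
      have "(?r has_derivative (\<lambda>h. (-1/2) * (?r x * (?r x * ?r x)) * frechet_derivative f (at x)
        h)) (at x)"
        using has_derivative_compose[OF f(1)[OF that] *[unfolded has_field_derivative_def eq]] .
      then show ?thesis
        by (rule has_derivative_eq_rhs) (simp only: mult_ac)
    qed
    show "C_k_on n S (\<lambda>x. (-1/2) * (frechet_derivative f (at x) h * (?r x * (?r x * ?r x))))" for h
      using Suc.IH[OF C_k_on_Suc_imp[OF Suc.prems]] f(2)[of h]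
      by (intro C_k_on_mult[OF assms(1)] C_k_on_const)
  qed
qed

section \<open>Closure properties of smooth maps\<close>

lemma smooth_on_subset: "smooth_on S f \<Longrightarrow> T \<subseteq> S \<Longrightarrow> smooth_on T f"
  unfolding smooth_on_def using C_k_on_subset by blast

lemma smooth_on_cong: "open S \<Longrightarrow> (\<And>x. x \<in> S \<Longrightarrow> f x = g x) \<Longrightarrow> smooth_on S f \<Longrightarrow> smooth_on S g"
  unfolding smooth_on_def using C_k_on_cong by blast

lemma smooth_on_const: "smooth_on S (\<lambda>x. c)"
  unfolding smooth_on_def using C_k_on_const by blast

lemma smooth_on_add: "open S \<Longrightarrow> smooth_on S f \<Longrightarrow> smooth_on S g \<Longrightarrow> smooth_on S (\<lambda>x. f x + g x)"
  unfolding smooth_on_def using C_k_on_add by blast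

lemma smooth_on_mult:
  fixes f g :: "'v::euclidean_space \<Rightarrow> 'b::real_normed_algebra"
  shows "open S \<Longrightarrow> smooth_on S f \<Longrightarrow> smooth_on S g \<Longrightarrow> smooth_on S (\<lambda>x. f x * g x)"
  unfolding smooth_on_def using C_k_on_mult by blast

lemma smooth_on_linear_comp:
  "open S \<Longrightarrow> bounded_linear L \<Longrightarrow> smooth_on S f \<Longrightarrow> smooth_on S (\<lambda>x. L (f x))"
  unfolding smooth_on_def using C_k_on_linear_comp by blast

lemma smooth_on_comp_linear:
  fixes L :: "'u::euclidean_space \<Rightarrow> 'v::euclidean_space"
  shows "open S \<Longrightarrow> bounded_linear L \<Longrightarrow> L ` S \<subseteq> T \<Longrightarrow> smooth_on T f \<Longrightarrow> smooth_on S (\<lambda>x. f (L x))"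
  unfolding smooth_on_def using C_k_on_comp_linear by blast

lemma smooth_on_rsqrt:
  "open S \<Longrightarrow> smooth_on S f \<Longrightarrow> (\<And>x. x \<in> S \<Longrightarrow> f x > 0) \<Longrightarrow> smooth_on S (\<lambda>x. 1 / sqrt (f x))"
  unfolding smooth_on_def using C_k_on_rsqrt by blast

lemma smooth_on_inverse:
  fixes f :: "'v::euclidean_space \<Rightarrow> real"
  assumes "open S" "smooth_on S f" "\<And>x. x \<in> S \<Longrightarrow> f x > 0"
  shows "smooth_on S (\<lambda>x. 1 / f x)"
  by (rule smooth_on_cong[OF assms(1) _ smooth_on_mult[OF assms(1) smooth_on_rsqrt[OF assms]
    smooth_on_rsqrt[OF assms]]])
    (use assms(3) in \<open>auto simp: less_imp_le\<close>)

lemma smooth_on_sqrt: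
  assumes "open S" "smooth_on S f" "\<And>x. x \<in> S \<Longrightarrow> f x > 0"
  shows "smooth_on S (\<lambda>x. sqrt (f x))"
  by (rule smooth_on_cong[OF assms(1) _ smooth_on_mult[OF assms(1,2) smooth_on_rsqrt[OF assms]]])
    (use assms(3) in \<open>auto simp: real_div_sqrt less_imp_le\<close>)

lemma smooth_on_diff:
  fixes f g :: "'v::euclidean_space \<Rightarrow> 'b::real_normed_vector"
  assumes "open S" "smooth_on S f" "smooth_on S g"
  shows "smooth_on S (\<lambda>x. f x - g x)"
  using smooth_on_add[OF assms(1,2) smooth_on_linear_comp[OF assms(1) _ assms(3), of uminus]]
  by (simp add: bounded_linear_minus bounded_linear_ident)

lemma smooth_on_sum:
  assumes "open S" "\<And>i. i \<in> A \<Longrightarrow> smooth_on S (f i)"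
  shows "smooth_on S (\<lambda>x. \<Sum>i\<in>A. f i x)"
  using assms(2) by (induction A rule: infinite_finite_induct)
    (auto intro: smooth_on_const smooth_on_add[OF assms(1)])

lemma smooth_on_linear:
  fixes L :: "'v::euclidean_space \<Rightarrow> 'w::real_normed_vector"
  assumes "open S" "bounded_linear L"
  shows "smooth_on S L"
proof -
  have "C_k_on (Suc n) S L" for n
    by (rule C_k_on_SucI[OF assms(1)]) (auto intro: bounded_linear_imp_has_derivative assms
      C_k_on_const)
  then show ?thesis unfolding smooth_on_def using C_k_on_Suc_imp by blast
qed

lemma smooth_on_Pair:
  assumes "open S" "smooth_on S f" "smooth_on S g"
  shows "smooth_on S (\<lambda>x. (f x, g x))"
proof -
  have "bounded_linear (\<lambda>a. (a, 0))" "bounded_linear (\<lambda>b. (0, b))"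
    by (auto intro: bounded_linear_Pair bounded_linear_ident bounded_linear_zero)
  from smooth_on_add[OF assms(1) smooth_on_linear_comp[OF assms(1) this(1) assms(2)]
      smooth_on_linear_comp[OF assms(1) this(2) assms(3)]]
  show ?thesis by simp
qed

lemma smooth_onD:
  assumes "smooth_on S f"
  shows "x \<in> S \<Longrightarrow> f differentiable (at x)" "continuous_on S f"
  using assms[unfolded smooth_on_def, rule_format, of 1] assms[unfolded smooth_on_def, rule_format,
    of 0]
  by simp_all

section \<open>Alternating forms\<close>

lemma alt_formD:
  assumes "alt_form k f"
  shows "(\<And>i. i < k \<Longrightarrow> v i = w i) \<Longrightarrow> f v = f w"
    and "i < k \<Longrightarrow> linear (\<lambda>x. f (v(i := x)))"
    and "i < k \<Longrightarrow> j < k \<Longrightarrow> i \<noteq> j \<Longrightarrow> v i = v j \<Longrightarrow> f v = 0"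
  using assms unfolding alt_form_def by blast+

text \<open>In each summand a given argument enters exactly one of the two factors, which gives
  linearity. If two arguments agree, composing with their transposition permutes the summands and
  reverses their signs, so the sum equals its own negative.\<close>

lemma alt_form_alt_wedge:
  assumes f: "alt_form k f" and g: "alt_form l g"
  shows "alt_form (k + l) (alt_wedge k l f g)"
proof -
  let ?P = "{\<sigma>. \<sigma> permutes {..<k + l}}"
  define T where "T v \<sigma> = of_int (sign \<sigma>) * f (v \<circ> \<sigma>) * g (\<lambda>i. v (\<sigma> (k + i)))" for v \<sigma>
  have aw: "alt_wedge k l f g v = (\<Sum>\<sigma>\<in>?P. T v \<sigma>) / (fact k * fact l)" for v
    by (simp add: alt_wedge_def T_def)
  have lt: "\<sigma> i < k + l" if "\<sigma> \<in> ?P" "i < k + l" for \<sigma> i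
    using permutes_in_image[of \<sigma> "{..<k + l}" i] that by simp
  have "alt_wedge k l f g v = alt_wedge k l f g w" if "\<forall>i<k + l. v i = w i" for v w
  proof -
    have "f (v \<circ> \<sigma>) = f (w \<circ> \<sigma>)" if "\<sigma> \<in> ?P" for \<sigma>
      by (rule alt_formD(1)[OF f]) (use lt[OF that] \<open>\<forall>i<k + l. v i = w i\<close> in simp)
    moreover have "g (\<lambda>i. v (\<sigma> (k + i))) = g (\<lambda>i. w (\<sigma> (k + i)))" if "\<sigma> \<in> ?P" for \<sigma>
      by (rule alt_formD(1)[OF g]) (use lt[OF that] \<open>\<forall>i<k + l. v i = w i\<close> in simp)
    ultimately show ?thesis by (simp add: aw T_def)
  qed
  moreover have "linear (\<lambda>x. alt_wedge k l f g (v(i := x)))" if "i < k + l" for i v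
  proof -
    have "linear (\<lambda>x. T (v(i := x)) \<sigma>)" if \<sigma>: "\<sigma> \<in> ?P" for \<sigma>
    proof -
      \<comment> \<open>\<open>j\<close> is the slot into which the summand of \<sigma> puts
        argument \<open>i\<close>: a slot of \<open>f\<close> if \<open>j < k\<close>, and slot
        \<open>j - k\<close> of \<open>g\<close> otherwise.\<close>
      define j where "j = inv \<sigma> i"
      have j: "\<sigma> j = i" "j < k + l"
        using \<sigma> \<open>i < k + l\<close> permutes_inverses(1)[of \<sigma>] permutes_in_image[OF permutes_inv, of \<sigma>
          "{..<k+l}" i]
        by (auto simp: j_def)
      have inj: "\<sigma> m = i \<longleftrightarrow> m = j" for m
        using j(1) permutes_inj[of \<sigma>] \<sigma> by (metis injD mem_Collect_eq)
      show ?thesis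
      proof (cases "j < k")
        case True
        have e1: "(v(i := x)) \<circ> \<sigma> = (v \<circ> \<sigma>)(j := x)" for x
          by (auto simp: fun_eq_iff inj)
        have e2: "(\<lambda>m. (v(i := x)) (\<sigma> (k + m))) = (\<lambda>m. v (\<sigma> (k + m)))" for x
          using True by (auto simp: fun_eq_iff inj)
        have "linear (\<lambda>x. f ((v \<circ> \<sigma>)(j := x)))" using alt_formD(2)[OF f True] .
        then show ?thesis
          unfolding T_def e1 e2
          by (auto simp: linear_iff algebra_simps)
      next
        case False
        have e1: "f ((v(i := x)) \<circ> \<sigma>) = f (v \<circ> \<sigma>)" for x
          by (rule alt_formD(1)[OF f]) (use False in \<open>auto simp: inj\<close>)
        have e2: "(\<lambda>m. (v(i := x)) (\<sigma> (k + m))) = (\<lambda>m. v (\<sigma> (k + m)))(j - k := x)" for x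
          using False by (auto simp: fun_eq_iff inj)
        have "linear (\<lambda>x. g ((\<lambda>m. v (\<sigma> (k + m)))(j - k := x)))"
          by (rule alt_formD(2)[OF g]) (use False j(2) in simp)
        then show ?thesis
          unfolding T_def e1 e2
          by (auto simp: linear_iff algebra_simps)
      qed
    qed
    then have "linear (\<lambda>x. \<Sum>\<sigma>\<in>?P. T (v(i := x)) \<sigma>)"
      by (intro linear_compose_sum) auto
    then show ?thesis
      unfolding aw by (auto simp: linear_iff divide_inverse distrib_right)
  qed
  moreover have "alt_wedge k l f g v = 0" if "i < k + l" "j < k + l" "i \<noteq> j" "v i = v j" for i j v
  proof -
    let ?\<tau> = "Transposition.transpose i j"
    have \<tau>: "?\<tau> permutes {..<k + l}" using that by (auto intro: permutes_swap_id)
    have vt: "v (?\<tau> m) = v m" for m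
      using that by (auto simp: Transposition.transpose_def)
    have "T v (?\<tau> \<circ> \<sigma>) = - T v \<sigma>" if \<sigma>: "\<sigma> \<in> ?P" for \<sigma>
    proof -
      have "sign (?\<tau> \<circ> \<sigma>) = - sign \<sigma>"
        using \<sigma> \<open>i \<noteq> j\<close> permutation_permutes[of \<sigma>]
        by (subst sign_compose) (auto simp: sign_swap_id permutation_swap_id intro!: exI[of _
          "{..<k+l}"])
      then show ?thesis by (simp add: T_def comp_def vt)
    qed
    moreover have "(\<Sum>\<sigma>\<in>?P. T v (?\<tau> \<circ> \<sigma>)) = (\<Sum>\<sigma>\<in>?P. T v \<sigma>)"
      using setum_permutations_compose_left[OF \<tau>, of "T v"] by simp
    ultimately have "(\<Sum>\<sigma>\<in>?P. T v \<sigma>) = - (\<Sum>\<sigma>\<in>?P. T v \<sigma>)"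
      by (simp add: sum_negf)
    then have "(\<Sum>\<sigma>\<in>?P. T v \<sigma>) = 0"
      by (simp add: eq_neg_iff_add_eq_0 flip: mult_2)
    then show ?thesis by (simp add: aw)
  qed
  ultimately show ?thesis unfolding alt_form_def by blast
qed

text \<open>A permutation of \<open>n + 1\<close> points is one of \<open>n\<close> points followed
  by a transposition of \<open>n\<close> with some \<open>i \<le> n\<close>; the case
  \<open>i = n\<close> is the identity and gives the first sum. Repeated unfolding makes sums over
  permutations of few points explicit.\<close>

lemma sum_permutes_insert_lessThan:
  fixes T :: "(nat \<Rightarrow> nat) \<Rightarrow> 'b::ring_1"
  shows "(\<Sum>\<sigma> | \<sigma> permutes {..<Suc n}. of_int (sign \<sigma>) * T \<sigma>) =
    (\<Sum>\<sigma> | \<sigma> permutes {..<n}. of_int (sign \<sigma>) * T \<sigma>)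
    - (\<Sum>i<n. \<Sum>\<sigma> | \<sigma> permutes {..<n}. of_int (sign \<sigma>) * T (Transposition.transpose n i \<circ> \<sigma>))"
proof -
  have "sign (Transposition.transpose n i \<circ> \<sigma>) = - sign \<sigma>" if "\<sigma> permutes {..<n}" "i < n" for \<sigma> i
    using that permutation_permutes[of \<sigma>]
    by (subst sign_compose) (auto simp: sign_swap_id permutation_swap_id intro!: exI[of _ "{..<n}"])
  then show ?thesis
    by (simp add: lessThan_Suc sum_over_permutations_insert sum_negf)
qed

lemma permutes_lessThan_0: "{\<sigma>::nat \<Rightarrow> nat. \<sigma> permutes {..<0}} = {id}"
  by (auto simp: permutes_empty)

text \<open>The same sequence as in the sign condition of \<open>SU2_structure\<close>. The entries
  from index 2 on are padding that a 2-form does not see.\<close>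

definition vec2 :: "'v \<Rightarrow> 'v \<Rightarrow> nat \<Rightarrow> 'v" where
  "vec2 a b = case_nat a (\<lambda>_. b)"

lemma alt_form_1_eq: "alt_form 1 f \<Longrightarrow> f v = f (\<lambda>_. v 0)"
  by (rule alt_formD(1)) auto

lemma alt_form_2_eq: "alt_form 2 f \<Longrightarrow> f v = f (vec2 (v 0) (v 1))"
  by (rule alt_formD(1)) (auto simp: vec2_def less_2_cases_iff)

lemma alt_form_2_alt:
  assumes "alt_form 2 f"
  shows "f (vec2 a a) = 0" "f (vec2 a b) = - f (vec2 b a)"
    and "linear (\<lambda>x. f (vec2 x b))" "linear (\<lambda>x. f (vec2 a x))"
proof -
  show *: "f (vec2 a a) = 0" for a
    by (rule alt_formD(3)[OF assms, of 0 1]) (auto simp: vec2_def)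
  show l1: "linear (\<lambda>x. f (vec2 x b))" for b
    using alt_formD(2)[OF assms, of 0 "vec2 b b"] alt_form_2_eq[OF assms, of "(vec2 b b)(0:=_)"]
    by (auto simp: vec2_def)
  show l2: "linear (\<lambda>x. f (vec2 a x))" for a
    using alt_formD(2)[OF assms, of 1 "vec2 a a"] alt_form_2_eq[OF assms, of "(vec2 a a)(1:=_)"]
    by (auto simp: vec2_def)
  show "f (vec2 a b) = - f (vec2 b a)"
    using *[of "a + b"] *[of a] *[of b] 
    by (simp add: linear_add[OF l1] linear_add[OF l2] eq_neg_iff_add_eq_0 add.commute)
qed

section \<open>Wedge products of low degree as explicit polynomials\<close>

lemma alt_wedge_1_1:
  assumes "alt_form 1 f" "alt_form 1 g"
  shows "alt_wedge 1 1 f g v = f (\<lambda>_. v 0) * g (\<lambda>_. v 1) - f (\<lambda>_. v 1) * g (\<lambda>_. v 0)"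
proof -
  have "alt_wedge 1 1 f g v =
    (\<Sum>\<sigma> | \<sigma> permutes {..<Suc (Suc 0)}. of_int (sign \<sigma>) * (f (\<lambda>_. v (\<sigma> 0)) * g (\<lambda>_. v (\<sigma> 1))))"
    unfolding alt_wedge_def
    by (subst alt_form_1_eq[OF assms(1)], subst alt_form_1_eq[OF assms(2)])
      (simp add: mult.assoc numeral_2_eq_2)
  also have "\<dots> = f (\<lambda>_. v 0) * g (\<lambda>_. v 1) - f (\<lambda>_. v 1) * g (\<lambda>_. v 0)"
    unfolding sum_permutes_insert_lessThan permutes_lessThan_0
    by (simp add: Transposition.transpose_def)
  finally show ?thesis .
qed

lemma alt_wedge_2_1:
  assumes f: "alt_form 2 f" and g: "alt_form 1 g"
  shows "alt_wedge 2 1 f g v = f (vec2 (v 0) (v 1)) * g (\<lambda>_. v 2)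
    - f (vec2 (v 0) (v 2)) * g (\<lambda>_. v 1) + f (vec2 (v 1) (v 2)) * g (\<lambda>_. v 0)"
proof -
  have "alt_wedge 2 1 f g v =
    (\<Sum>\<sigma> | \<sigma> permutes {..<Suc (Suc (Suc 0))}. of_int (sign \<sigma>) *
      (f (vec2 (v (\<sigma> 0)) (v (\<sigma> 1))) * g (\<lambda>_. v (\<sigma> 2)))) / 2"
    unfolding alt_wedge_def
    by (subst alt_form_2_eq[OF f], subst alt_form_1_eq[OF g])
      (simp add: mult.assoc numeral_3_eq_3 comp_def)
  also have "\<dots> = f (vec2 (v 0) (v 1)) * g (\<lambda>_. v 2)
    - f (vec2 (v 0) (v 2)) * g (\<lambda>_. v 1) + f (vec2 (v 1) (v 2)) * g (\<lambda>_. v 0)"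
    unfolding sum_permutes_insert_lessThan permutes_lessThan_0
    by (simp add: Transposition.transpose_def lessThan_Suc numeral_2_eq_2 
        alt_form_2_alt(2)[OF f, of "v (Suc 0)" "v 0"] alt_form_2_alt(2)[OF f, of "v (Suc (Suc 0))"
          "v 0"]
         alt_form_2_alt(2)[OF f, of "v (Suc (Suc 0))" "v (Suc 0)"])
  finally show ?thesis .
qed

text \<open>The 24 permutations fall into six shuffles of four each, since swapping the arguments
  within \<open>f\<close> or within \<open>g\<close> changes both a sign of the form and that of the
  permutation. This cancels the factor \<open>1 / (fact 2 * fact 2)\<close>.\<close>

lemma alt_wedge_2_2:
  assumes f: "alt_form 2 f" and g: "alt_form 2 g"
  shows "alt_wedge 2 2 f g v =
      f (vec2 (v 0) (v 1)) * g (vec2 (v 2) (v 3)) - f (vec2 (v 0) (v 2)) * g (vec2 (v 1) (v 3))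
    + f (vec2 (v 0) (v 3)) * g (vec2 (v 1) (v 2)) + f (vec2 (v 1) (v 2)) * g (vec2 (v 0) (v 3))
    - f (vec2 (v 1) (v 3)) * g (vec2 (v 0) (v 2)) + f (vec2 (v 2) (v 3)) * g (vec2 (v 0) (v 1))"
proof -
  have 3: "3 = Suc (Suc (Suc 0))" and 4: "(4::nat) = Suc (Suc (Suc (Suc 0)))" by simp_all
  have "alt_wedge 2 2 f g v =
    (\<Sum>\<sigma> | \<sigma> permutes {..<4}. of_int (sign \<sigma>) *
      (f (vec2 (v (\<sigma> 0)) (v (\<sigma> 1))) * g (vec2 (v (\<sigma> 2)) (v (\<sigma> 3))))) / 4"
    unfolding alt_wedge_def
    by (subst alt_form_2_eq[OF f], subst alt_form_2_eq[OF g])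
      (simp add: mult.assoc comp_def)
  also have "\<dots> = f (vec2 (v 0) (v 1)) * g (vec2 (v 2) (v 3))
    - f (vec2 (v 0) (v 2)) * g (vec2 (v 1) (v 3))
    + f (vec2 (v 0) (v 3)) * g (vec2 (v 1) (v 2)) + f (vec2 (v 1) (v 2)) * g (vec2 (v 0) (v 3))
    - f (vec2 (v 1) (v 3)) * g (vec2 (v 0) (v 2)) + f (vec2 (v 2) (v 3)) * g (vec2 (v 0) (v 1))"
    unfolding 4 sum_permutes_insert_lessThan permutes_lessThan_0
    by (simp add: Transposition.transpose_def lessThan_Suc numeral_2_eq_2 3
        alt_form_2_alt(2)[OF f, of "v (Suc 0)" "v 0"] alt_form_2_alt(2)[OF f, of "v (Suc (Suc 0))"
          "v 0"]
        alt_form_2_alt(2)[OF f, of "v (Suc (Suc 0))" "v (Suc 0)"]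
        alt_form_2_alt(2)[OF f, of "v (Suc (Suc (Suc 0)))"]
        alt_form_2_alt(2)[OF g, of "v (Suc 0)" "v 0"] alt_form_2_alt(2)[OF g, of "v (Suc (Suc 0))"
          "v 0"]
        alt_form_2_alt(2)[OF g, of "v (Suc (Suc 0))" "v (Suc 0)"]
        alt_form_2_alt(2)[OF g, of "v (Suc (Suc (Suc 0)))"])
  finally show ?thesis .
qed

section \<open>The normal form of an SU(2)-structure at a point\<close>

definition skew :: "('v::real_vector \<Rightarrow> 'v \<Rightarrow> real) \<Rightarrow> bool" where
  "skew A \<longleftrightarrow> (\<forall>y. linear (\<lambda>x. A x y)) \<and> (\<forall>x y. A x y = - A y x)"

text \<open>The curried counterpart of \<open>alt_wedge 2 2\<close>, so that relations between
  values become polynomial identities.\<close>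

definition wedge22 ::
    "('v \<Rightarrow> 'v \<Rightarrow> real) \<Rightarrow> ('v \<Rightarrow> 'v \<Rightarrow> real) \<Rightarrow> 'v \<Rightarrow> 'v \<Rightarrow> 'v \<Rightarrow> 'v \<Rightarrow> real" where
  "wedge22 A B a b c d = A a b * B c d - A a c * B b d + A a d * B b c
    + A b c * B a d - A b d * B a c + A c d * B a b"

lemma skewD:
  assumes "skew A"
  shows "A x x = 0" "A (x + y) z = A x z + A y z" "A z (x + y) = A z x + A z y"
    "A (r *\<^sub>R x) z = r * A x z" "A z (r *\<^sub>R x) = r * A z x"
    "A (x - y) z = A x z - A y z" "A z (x - y) = A z x - A z y"
    "A 0 z = 0" "A z 0 = 0" "linear (\<lambda>x. A x z)" "linear (A z)"
proof -
  have s: "A x y = - A y x" for x y using assms unfolding skew_def by blast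
  show l: "linear (\<lambda>x. A x z)" for z using assms unfolding skew_def by blast
  have "linear (\<lambda>x. - A x z)" using linear_compose_neg[OF l] .
  then show l': "linear (A z)" by (simp flip: s)
  show "A x x = 0" using s[of x x] by simp
  show "A (x + y) z = A x z + A y z" "A (r *\<^sub>R x) z = r * A x z" "A (x - y) z = A x z - A y z"
    "A 0 z = 0"
    using linear_add[OF l] linear_scale[OF l] linear_diff[OF l] linear_0[OF l] by auto
  show "A z (x + y) = A z x + A z y" "A z (r *\<^sub>R x) = r * A z x" "A z (x - y) = A z x - A z y"
    "A z 0 = 0"
    using linear_add[OF l'] linear_scale[OF l'] linear_diff[OF l'] linear_0[OF l'] by auto
qed

lemma skew_swap: "skew A \<Longrightarrow> A x y = - A y x"
  unfolding skew_def by blast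

lemma skew_neg: "skew A \<Longrightarrow> A x y = r \<Longrightarrow> A y x = - r"
  using skew_swap by metis

text \<open>The matrix of \<open>A\<close> satisfies \<open>transpose M = - M\<close>, so
  \<open>det M = (-1)^n * det M\<close>, and odd \<open>n\<close> makes the determinant
  zero.\<close>

lemma skew_odd_dim_kernel:
  fixes A :: "real ^ 'n \<Rightarrow> real ^ 'n \<Rightarrow> real"
  assumes A: "skew A" and odd: "odd (CARD('n))"
  obtains \<xi> where "\<xi> \<noteq> 0" "\<And>y. A \<xi> y = 0"
proof -
  \<comment> \<open>With this order of indices the entries of \<open>M *v \<xi>\<close> are
    \<open>A \<xi> (axis i 1)\<close>.\<close>
  define M :: "real ^ 'n ^ 'n" where "M = (\<chi> i j. A (axis j 1) (axis i 1))"
  have "transpose M = (\<chi> i. (- 1) *s row i M)"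
    unfolding transpose_def M_def row_def vec_eq_iff
    by (simp, subst skew_swap[OF A], simp)
  then have "det M = det (\<chi> i. (- 1) *s row i M)"
    by (metis det_transpose)
  also have "\<dots> = (- 1) ^ CARD('n) * det M"
    using det_rows_mul[of "\<lambda>_. -1" "\<lambda>i. row i M"]
    by (simp add: row_def)
  finally have "det M = 0" using odd by simp
  then obtain \<xi> where \<xi>: "\<xi> \<noteq> 0" "M *v \<xi> = 0"
    using invertible_det_nz[of M] invertible_left_inverse[of M] matrix_left_invertible_ker[of M]
      by blast
  have lin: "A \<xi> y = (\<Sum>i\<in>UNIV. y $ i * A \<xi> (axis i 1))" for y \<xi>
    using linear_sum[OF skewD(11)[OF A, of \<xi>], of "\<lambda>i. y $ i *\<^sub>R axis i 1" UNIV]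
      basis_expansion[of y] by (simp add: skewD(5)[OF A] scalar_mult_eq_scaleR)
  have "A \<xi> (axis i 1) = 0" for i
  proof -
    have "A \<xi> (axis i 1) = - (\<Sum>j\<in>UNIV. \<xi> $ j * A (axis i 1) (axis j 1))"
      by (subst skew_swap[OF A], subst lin) simp
    also have "\<dots> = (M *v \<xi>) $ i"
      by (auto simp: matrix_vector_mult_def M_def sum_negf[symmetric] mult.commute skew_swap[OF A,
        of "axis i 1"] intro!: sum.cong)
    finally show ?thesis using \<xi>(2) by simp
  qed
  then have "A \<xi> y = 0" for y by (subst lin) simp
  with \<xi>(1) show ?thesis by (rule that)
qed

text \<open>If \<open>A\<close> annihilates \<open>\<xi>\<close> then \<open>A \<and> i\<^sub>\<xi>B = 0\<close>, and \<open>A\<close> would be decomposable if \<open>i\<^sub>\<xi>B \<noteq> 0\<close>.\<close>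

lemma kernel_shared:
  assumes A: "skew A" and B: "skew B" and AB: "\<And>a b c d. wedge22 A B a b c d = 0"
    and AA: "wedge22 A A p q r s \<noteq> 0" and \<xi>: "\<And>y. A \<xi> y = 0"
  shows "B \<xi> y = 0"
proof (rule ccontr)
  assume k: "B \<xi> y \<noteq> 0"
  have *: "B \<xi> y * A b c = A y c * B \<xi> b - A y b * B \<xi> c" for b c
    using AB[of \<xi> y b c] unfolding wedge22_def by (simp add: \<xi> algebra_simps)
  have "B \<xi> y * B \<xi> y * wedge22 A A p q r s = 2 * ((B \<xi> y * A p q) * (B \<xi> y * A r s)
      - (B \<xi> y * A p r) * (B \<xi> y * A q s) + (B \<xi> y * A p s) * (B \<xi> y * A q r))"
    unfolding wedge22_def by algebra
  also have "\<dots> = 0" unfolding * by algebra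
  finally have "wedge22 A A p q r s = 0" using k by simp
  with AA show False by simp
qed

text \<open>Multiplicativity in the form det(M) det(N) = det(M N^T): the entries \<open>p\<close>
  pair rows of one matrix with rows of the other, which is how wedge products of a 1-form with a
  2-form on a 3-space appear.\<close>

lemma det3_mult:
  fixes m11 m12 m13 m21 m22 m23 m31 m32 m33 :: real
  shows "(m11 * (m22 * m33 - m23 * m32) - m12 * (m21 * m33 - m23 * m31) + m13 * (m21 * m32
      - m22 * m31)) *
    (n11 * (n22 * n33 - n23 * n32) - n12 * (n21 * n33 - n23 * n31) + n13 * (n21 * n32 - n22 * n31)) =
    (let p = \<lambda>a b c x y z. a * x + b * y + c * z;
       p11 = p m11 m12 m13 n11 n12 n13; p12 = p m11 m12 m13 n21 n22 n23; p13
         = p m11 m12 m13 n31 n32 n33;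
       p21 = p m21 m22 m23 n11 n12 n13; p22 = p m21 m22 m23 n21 n22 n23; p23
         = p m21 m22 m23 n31 n32 n33;
       p31 = p m31 m32 m33 n11 n12 n13; p32 = p m31 m32 m33 n21 n22 n23; p33
         = p m31 m32 m33 n31 n32 n33
     in p11 * (p22 * p33 - p23 * p32) - p12 * (p21 * p33 - p23 * p31) + p13 * (p21 * p32
       - p22 * p31))"
  unfolding Let_def by algebra

text \<open>With \<open>\<alpha>\<^sub>i = i\<^sub>X\<omega>\<^sub>i\<close>, these are \<open>\<alpha>\<^sub>1 \<and> \<alpha>\<^sub>2 \<and> \<alpha>\<^sub>3\<close> evaluated at \<open>(u, v, w)\<close> and \<open>\<alpha>\<^sub>1 \<and> i\<^sub>Y\<omega>\<^sub>2
  \<and> \<omega>\<^sub>3\<close> evaluated at \<open>(X, u, v, w)\<close>. The latter is proportional to the inner product of \<open>X\<close> and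
  \<open>Y\<close>.\<close>

definition contracted_det ::
    "('v \<Rightarrow> 'v \<Rightarrow> real) \<Rightarrow> ('v \<Rightarrow> 'v \<Rightarrow> real) \<Rightarrow> ('v \<Rightarrow> 'v \<Rightarrow> real) \<Rightarrow> 'v \<Rightarrow> 'v \<Rightarrow> 'v \<Rightarrow> 'v \<Rightarrow> real" where
  "contracted_det A B C X u v w = A X u * (B X v * C X w - B X w * C X v) - A X v * (B X u * C X w
    - B X w * C X u)
     + A X w * (B X u * C X v - B X v * C X u)"

definition contracted_num ::
    "('v \<Rightarrow> 'v \<Rightarrow> real) \<Rightarrow> ('v \<Rightarrow> 'v \<Rightarrow> real) \<Rightarrow> ('v \<Rightarrow> 'v \<Rightarrow> real) \<Rightarrow> 'v \<Rightarrow> 'v \<Rightarrow> 'v \<Rightarrow> 'v \<Rightarrow> 'v \<Rightarrow> real" where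
  "contracted_num A B C X u v w Y = B X Y * (A X u * C v w - A X v * C u w + A X w * C u v)
     + (A X u * (B Y v * C X w - B Y w * C X v) - A X v * (B Y u * C X w - B Y w * C X u)
     + A X w * (B Y u * C X v - B Y v * C X u))"

lemma linear_contracted_num:
  assumes "skew B"
  shows "linear (contracted_num A B C X u v w)"
  by (rule linearI)
    (simp_all only: contracted_num_def skewD(2-5)[OF assms] real_scaleR_def, simp_all only:
      algebra_simps)

text \<open>The quadratic relations at a single point. Nonvanishing of \<open>nu\<close>, the common
  kernel vector and the sign condition enter as hypotheses of the individual lemmas.\<close>

locale skew_triple =
  fixes A B C :: "real ^ 5 \<Rightarrow> real ^ 5 \<Rightarrow> real" and nu :: "real ^ 5 \<Rightarrow> real ^ 5 \<Rightarrow> real ^ 5 \<Rightarrow> real ^ 5 \<Rightarrow>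
      real"
  assumes skew: "skew A" "skew B" "skew C"
    and diag: "wedge22 A A a b c d = nu a b c d" "wedge22 B B a b c d = nu a b c d"
      "wedge22 C C a b c d = nu a b c d"
    and offdiag: "wedge22 A B a b c d = 0" "wedge22 A C a b c d = 0" "wedge22 B C a b c d = 0"
begin

lemmas bilin = skewD(1-9)[OF skew(1)] skewD(1-9)[OF skew(2)] skewD(1-9)[OF skew(3)]

abbreviation "det_w \<equiv> contracted_det A B C"

text \<open>Let \<open>m\<^sub>i = i\<^sub>X\<omega>\<^sub>i\<close> and \<open>n\<^sub>i = *\<omega>\<^sub>i\<close> on the span of \<open>u, v, w\<close>. The quadratic relations say
  that \<open>m n\<^sup>T\<close> is the sum of \<open>\<nu>/2\<close> times the identity and a skew matrix, whose determinant is not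
  zero.\<close>

lemma det_w_nonzero:
  assumes "nu X u v w \<noteq> 0"
  shows "det_w X u v w \<noteq> 0"
proof
  assume D: "det_w X u v w = 0"
  define h where "h = nu X u v w / 2"
  define p12 p13 p23 where
    "p12 = A X u * B v w + A X v * (- B u w) + A X w * B u v"
    and "p13 = A X u * C v w + A X v * (- C u w) + A X w * C u v"
    and "p23 = B X u * C v w + B X v * (- C u w) + B X w * C u v"
  have "A X u * A v w + A X v * (- A u w) + A X w * A u v = h"
    "B X u * B v w + B X v * (- B u w) + B X w * B u v = h"
    "C X u * C v w + C X v * (- C u w) + C X w * C u v = h"
    "B X u * A v w + B X v * (- A u w) + B X w * A u v = - p12"
    "C X u * A v w + C X v * (- A u w) + C X w * A u v = - p13"
    "C X u * B v w + C X v * (- B u w) + C X w * B u v = - p23"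
    using diag[of X u v w] offdiag[of X u v w]
    unfolding wedge22_def h_def p12_def p13_def p23_def by (simp_all add: algebra_simps)
  note p = this p12_def[symmetric] p13_def[symmetric] p23_def[symmetric]
  \<comment> \<open>The arguments of \<open>det3_mult\<close> come in the order of first occurrence,
    \<open>m11 m22 m33 m23 m32 m12 m21 m31 m13\<close>, and likewise for \<open>n\<close>. A row of
    the second matrix lists the values of one 2-form on \<open>(v, w)\<close>,
    \<open>(w, u)\<close>, \<open>(u, v)\<close>.\<close>
  have "0 = h * (h * h - p23 * (- p23)) - p12 * (- p12 * h - p23 * (- p13))
    + p13 * ((- p12) * (- p23) - h * (- p13))"
    using det3_mult[of "A X u" "B X v" "C X w" "B X w" "C X v" "A X v" "B X u" "C X u" "A X w"
       "A v w" "- B u w" "C u v" "B u v" "- C u w" "- A u w" "B v w" "C v w"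
         "A u v", unfolded Let_def p]
      D unfolding contracted_det_def by simp
  also have "\<dots> = h * (h * h + p23 * p23 + p12 * p12 + p13 * p13)"
    by algebra
  finally have "h * h + p23 * p23 + p12 * p12 + p13 * p13 = 0"
    using assms unfolding h_def by simp
  moreover have "h * h > 0" using assms unfolding h_def by (simp add: zero_less_mult_iff) linarith
  moreover have "p23 * p23 \<ge> 0" "p12 * p12 \<ge> 0" "p13 * p13 \<ge> 0" by auto
  ultimately show False by linarith
qed

text \<open>Cramer's rule for the three contractions with \<open>X\<close> on
  \<open>w2, w3, w4\<close>; the coefficients passed to \<open>comb\<close> are the
  cofactors.\<close>

lemma dual_vectors:
  assumes "det_w X w2 w3 w4 \<noteq> 0"
  obtains u2 u3 u4 where "A X u2 = 1" "B X u2 = 0" "C X u2 = 0" "A X u3 = 0" "B X u3 = 1" "C X u3 = 0"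
    "A X u4 = 0" "B X u4 = 0" "C X u4 = 1"
proof -
  let ?D = "det_w X w2 w3 w4"
  define comb where "comb x y z = (x / ?D) *\<^sub>R w2 + (y / ?D) *\<^sub>R w3 + (z / ?D) *\<^sub>R w4" for x y z
  have c: "F X (comb x y z) = r" if "skew F" "x * F X w2 + y * F X w3 + z * F X w4 = r * ?D"
    for F x y z r
  proof -
    have "F X (comb x y z) = (x * F X w2 + y * F X w3 + z * F X w4) / ?D"
      unfolding comb_def by (simp add: skewD[OF that(1)] add_divide_distrib)
    then show ?thesis using that(2) assms by simp
  qed
  show ?thesis
    by (rule that[of "comb (B X w3 * C X w4 - B X w4 * C X w3) (B X w4 * C X w2
      - B X w2 * C X w4) (B X w2 * C X w3 - B X w3 * C X w2)"
      "comb (C X w3 * A X w4 - C X w4 * A X w3) (C X w4 * A X w2 - C X w2 * A X w4) (C X w2 * A X w3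
        - C X w3 * A X w2)"
      "comb (A X w3 * B X w4 - A X w4 * B X w3) (A X w4 * B X w2 - A X w2 * B X w4) (A X w2 * B X w3
        - A X w3 * B X w2)"];
      rule c; (rule skew)?; unfold contracted_det_def; algebra)
qed

text \<open>Dual vectors may be changed by multiples of \<open>X\<close>, which all three
  contractions annihilate. This freedom removes every value on pairs of dual vectors except the
  common one \<open>l\<close>.\<close>

lemma normal_vectors:
  assumes "det_w X w2 w3 w4 \<noteq> 0"
  obtains u2 u3 u4 l where "A X u2 = 1" "B X u2 = 0" "C X u2 = 0" "A X u3 = 0" "B X u3 = 1"
    "C X u3 = 0"
    "A X u4 = 0" "B X u4 = 0" "C X u4 = 1"
    "A u2 u3 = 0" "A u2 u4 = 0" "A u3 u4 = l" "B u2 u3 = 0" "B u2 u4 = - l" "B u3 u4 = 0"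
    "C u2 u3 = l" "C u2 u4 = 0" "C u3 u4 = 0"
proof -
  obtain v2 v3 v4 where v: "A X v2 = 1" "B X v2 = 0" "C X v2 = 0" "A X v3 = 0" "B X v3 = 1"
    "C X v3 = 0"
    "A X v4 = 0" "B X v4 = 0" "C X v4 = 1"
    by (rule dual_vectors[OF assms])
  have v': "A v2 X = -1" "B v2 X = 0" "C v2 X = 0" "A v3 X = 0" "B v3 X = -1" "C v3 X = 0"
    "A v4 X = 0" "B v4 X = 0" "C v4 X = -1"
    using v by (simp_all add: skew_swap[OF skew(1), of _ X] skew_swap[OF skew(2), of _ X]
      skew_swap[OF skew(3), of _ X])
  define l p q r where "l = A v3 v4" and "p = B v3 v4" and "q = C v3 v4" and "r = C v2 v4"
  note rel = diag[of X v2 v3 v4] offdiag[of X v2 v3 v4]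
  \<comment> \<open>There are nine values of the three forms on the pairs from
    \<open>v2, v3, v4\<close>. The relations at \<open>(X, v2, v3, v4)\<close> express five of them
    through \<open>l, p, q, r\<close>.\<close>
  have e: "A v2 v4 = p" "A v2 v3 = - q" "B v2 v3 = r" "B v2 v4 = - l" "C v2 v3 = l"
    using rel unfolding wedge22_def v l_def p_def q_def r_def by simp_all
  \<comment> \<open>Adding \<open>c\<close> times \<open>X\<close> to a dual vector shifts the
    values of its own form on that vector by \<open>c\<close> times a contraction, so the multiples
    are read off from \<open>e\<close>.\<close>
  show ?thesis
    by (rule that[of "v2 + (- r) *\<^sub>R X" "v3 + (- q) *\<^sub>R X" "v4 + p *\<^sub>R X" l])
      (simp_all add: bilin v v' e l_def[symmetric] p_def[symmetric] q_def[symmetric] r_def[symmetric])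
qed

text \<open>\<open>X, u2, u3, u4, \<xi>\<close> is a basis of the 5-space. By duality the
  coordinates along the \<open>u\<close>'s are the contractions with \<open>X\<close>, and expanding
  both arguments in this basis gives the three formulas.\<close>

lemma normal_form_coordinates:
  assumes D: "det_w X w2 w3 w4 \<noteq> 0" and \<xi>: "\<xi> \<noteq> 0" "\<And>y. A \<xi> y = 0" "\<And>y. B \<xi> y = 0" "\<And>y. C \<xi> y = 0"
  obtains u2 u3 u4 l a k where
    "A X u2 = 1" "B X u2 = 0" "C X u2 = 0" "A X u3 = 0" "B X u3 = 1" "C X u3 = 0"
    "A X u4 = 0" "B X u4 = 0" "C X u4 = 1"
    "\<And>Y. Y = a Y *\<^sub>R X + A X Y *\<^sub>R u2 + B X Y *\<^sub>R u3 + C X Y *\<^sub>R u4 + k Y *\<^sub>R \<xi>"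
    "\<And>Y Z. A Y Z = a Y * A X Z - a Z * A X Y + l * (B X Y * C X Z - C X Y * B X Z)"
    "\<And>Y Z. B Y Z = a Y * B X Z - a Z * B X Y + l * (C X Y * A X Z - A X Y * C X Z)"
    "\<And>Y Z. C Y Z = a Y * C X Z - a Z * C X Y + l * (A X Y * B X Z - B X Y * A X Z)"
proof -
  obtain u2 u3 u4 l where u: "A X u2 = 1" "B X u2 = 0" "C X u2 = 0" "A X u3 = 0" "B X u3 = 1"
    "C X u3 = 0"
    "A X u4 = 0" "B X u4 = 0" "C X u4 = 1"
    "A u2 u3 = 0" "A u2 u4 = 0" "A u3 u4 = l" "B u2 u3 = 0" "B u2 u4 = - l" "B u3 u4 = 0"
    "C u2 u3 = l" "C u2 u4 = 0" "C u3 u4 = 0"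
    by (rule normal_vectors[OF D])
  have \<xi>': "A y \<xi> = 0" "B y \<xi> = 0" "C y \<xi> = 0" for y
    using \<xi>(2-4)[of y] skew_swap[OF skew(1), of y \<xi>] skew_swap[OF skew(2), of y \<xi>] skew_swap[OF
      skew(3), of y \<xi>]
    by simp_all
  define L :: "real \<times> real \<times> real \<times> real \<times> real \<Rightarrow> real ^ 5" where
    "L = (\<lambda>(a, b, c, d, e). a *\<^sub>R X + b *\<^sub>R u2 + c *\<^sub>R u3 + d *\<^sub>R u4 + e *\<^sub>R \<xi>)"
  have lin: "linear L"
    by (auto simp: L_def linear_iff algebra_simps)
  have "inj L"
  proof (subst linear_injective_0[OF lin], clarify)
    fix a b c d e assume *: "L (a, b, c, d, e) = 0"
    have "A X (L (a, b, c, d, e)) = b" "B X (L (a, b, c, d, e)) = c" "C X (L (a, b, c, d, e)) = d"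
      by (simp_all add: L_def bilin u \<xi>')
    with * have "b = 0" "c = 0" "d = 0" by (simp_all add: bilin)
    \<comment> \<open>Contractions with \<open>X\<close> do not see the coefficient of
      \<open>X\<close>; pairing with \<open>u2\<close> recovers it, and then only a multiple of
      \<xi> is left.\<close>
    moreover have "A (L (a, b, c, d, e)) u2 = a" if "b = 0" "c = 0" "d = 0"
      by (simp add: L_def bilin u \<xi> that)
    ultimately have "a = 0" using * by (simp add: bilin)
    with * \<xi>(1) \<open>b = 0\<close> \<open>c = 0\<close> \<open>d = 0\<close> show "(a, b, c, d, e) = 0"
      by (simp add: L_def zero_prod_def)
  qed
  then have "dim (range L) = DIM(real ^ 5)"
    using dim_image_eq[OF lin, of UNIV] by simp
  then have "surj L"
    using dim_eq_full span_eq_iff[of "range L"] linear_subspace_image[OF lin subspace_UNIV] by metis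
  then obtain g where g: "\<And>Y. L (g Y) = Y" by (metis surj_f_inv_f)
  define a k where "a Y = fst (g Y)" and "k Y = snd (snd (snd (snd (g Y))))" for Y
  have ex: "Y = a Y *\<^sub>R X + A X Y *\<^sub>R u2 + B X Y *\<^sub>R u3 + C X Y *\<^sub>R u4 + k Y *\<^sub>R \<xi>" for Y
  proof -
    obtain b c d where Y: "Y = a Y *\<^sub>R X + b *\<^sub>R u2 + c *\<^sub>R u3 + d *\<^sub>R u4 + k Y *\<^sub>R \<xi>"
      using g[of Y] unfolding L_def a_def k_def by (cases "g Y") auto
    have "A X Y = b" "B X Y = c" "C X Y = d"
      by (subst Y, simp add: bilin u \<xi>')+
    with Y show ?thesis by simp
  qed
  note A' = skew_neg[OF skew(1)] and B' = skew_neg[OF skew(2)] and C' = skew_neg[OF skew(3)]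
  note u' = A'[OF u(1)] B'[OF u(2)] C'[OF u(3)] A'[OF u(4)] B'[OF u(5)] C'[OF u(6)] A'[OF u(7)]
    B'[OF u(8)] C'[OF u(9)]
    A'[OF u(10)] A'[OF u(11)] A'[OF u(12)] B'[OF u(13)] B'[OF u(14)] B'[OF u(15)] C'[OF u(16)] C'[OF
      u(17)] C'[OF u(18)]
  have "F Y Z = F (a Y *\<^sub>R X + A X Y *\<^sub>R u2 + B X Y *\<^sub>R u3 + C X Y *\<^sub>R u4 + k Y *\<^sub>R \<xi>)
      (a Z *\<^sub>R X + A X Z *\<^sub>R u2 + B X Z *\<^sub>R u3 + C X Z *\<^sub>R u4 + k Z *\<^sub>R \<xi>)"
        for F :: "real ^ 5 \<Rightarrow> real ^ 5 \<Rightarrow> real" and Y Z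
    using ex[of Y] ex[of Z] by simp
  note F = this
  have "A Y Z = a Y * A X Z - a Z * A X Y + l * (B X Y * C X Z - C X Y * B X Z)" for Y Z
    by (rule trans[OF F[of A Y Z]]) (simp add: bilin u u' \<xi> \<xi>', simp add: algebra_simps)
  moreover have "B Y Z = a Y * B X Z - a Z * B X Y + l * (C X Y * A X Z - A X Y * C X Z)" for Y Z
    by (rule trans[OF F[of B Y Z]]) (simp add: bilin u u' \<xi> \<xi>', simp add: algebra_simps)
  moreover have "C Y Z = a Y * C X Z - a Z * C X Y + l * (A X Y * B X Z - B X Y * A X Z)" for Y Z
    by (rule trans[OF F[of C Y Z]]) (simp add: bilin u u' \<xi> \<xi>', simp add: algebra_simps)
  ultimately show ?thesis
    by (rule that[OF u(1-9) ex])
qed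

abbreviation "num_w \<equiv> contracted_num A B C"

text \<open>Identifies the coordinate along \<open>X\<close> and the scalar of
  \<open>normal_form_coordinates\<close> with quotients that involve only
  \<open>X, w2, w3, w4\<close>. The vectors \<open>u2, u3, u4, \<xi>\<close> and the coordinate
  \<open>k\<close> do not occur in these quotients.\<close>

lemma normal_form:
  assumes D: "det_w X w2 w3 w4 \<noteq> 0" and \<xi>: "\<xi> \<noteq> 0" "\<And>y. A \<xi> y = 0" "\<And>y. B \<xi> y = 0" "\<And>y. C \<xi> y = 0"
  defines "f \<equiv> \<lambda>Y. num_w X w2 w3 w4 Y / det_w X w2 w3 w4"
    and "l \<equiv> nu X w2 w3 w4 / (2 * det_w X w2 w3 w4)"
  obtains u2 u3 u4 k where
    "A X u2 = 1" "B X u2 = 0" "C X u2 = 0" "A X u3 = 0" "B X u3 = 1" "C X u3 = 0"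
    "A X u4 = 0" "B X u4 = 0" "C X u4 = 1" "f X = 1" "f u2 = 0" "f u3 = 0" "f u4 = 0" "f \<xi> = 0"
    "\<And>Y. Y = f Y *\<^sub>R X + A X Y *\<^sub>R u2 + B X Y *\<^sub>R u3 + C X Y *\<^sub>R u4 + k Y *\<^sub>R \<xi>"
    "\<And>Y Z. A Y Z = f Y * A X Z - f Z * A X Y + l * (B X Y * C X Z - C X Y * B X Z)"
    "\<And>Y Z. B Y Z = f Y * B X Z - f Z * B X Y + l * (C X Y * A X Z - A X Y * C X Z)"
    "\<And>Y Z. C Y Z = f Y * C X Z - f Z * C X Y + l * (A X Y * B X Z - B X Y * A X Z)"
proof -
  obtain u2 u3 u4 l' a k where u: "A X u2 = 1" "B X u2 = 0" "C X u2 = 0" "A X u3 = 0" "B X u3 = 1"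
    "C X u3 = 0"
    "A X u4 = 0" "B X u4 = 0" "C X u4 = 1"
    and ex: "\<And>Y. Y = a Y *\<^sub>R X + A X Y *\<^sub>R u2 + B X Y *\<^sub>R u3 + C X Y *\<^sub>R u4 + k Y *\<^sub>R \<xi>"
    and A: "\<And>Y Z. A Y Z = a Y * A X Z - a Z * A X Y + l' * (B X Y * C X Z - C X Y * B X Z)"
    and B: "\<And>Y Z. B Y Z = a Y * B X Z - a Z * B X Y + l' * (C X Y * A X Z - A X Y * C X Z)"
    and C: "\<And>Y Z. C Y Z = a Y * C X Z - a Z * C X Y + l' * (A X Y * B X Z - B X Y * A X Z)"
    by (rule normal_form_coordinates[OF D \<xi>]) blast
  have fa: "f Y = a Y" for Y
  proof -
    have "num_w X w2 w3 w4 Y = a Y * det_w X w2 w3 w4"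
      unfolding contracted_num_def contracted_det_def B[of Y] C[of w2] C[of w3] by algebra
    then show ?thesis using D by (simp add: f_def)
  qed
  have l: "l = l'"
  proof -
    have "nu X w2 w3 w4 = 2 * l' * det_w X w2 w3 w4"
      unfolding diag(1)[symmetric] wedge22_def contracted_det_def A[of w2] A[of w3] by algebra
    then show ?thesis using D by (simp add: l_def)
  qed
  have fX: "f X = 1"
    using D unfolding f_def contracted_num_def contracted_det_def by (simp add: bilin)
  have \<xi>': "A y \<xi> = 0" "B y \<xi> = 0" "C y \<xi> = 0" for y
    using \<xi>(2-4)[of y] skew_swap[OF skew(1), of y \<xi>] skew_swap[OF skew(2), of y \<xi>] skew_swap[OF
      skew(3), of y \<xi>]
    by simp_all
  have "f \<xi> = 0"
    unfolding f_def contracted_num_def by (simp add: bilin \<xi> \<xi>')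
  have lin: "linear f"
    unfolding f_def using linear_compose_scale_right[OF linear_contracted_num[OF skew(2)], of
      "inverse (det_w X w2 w3 w4)"]
    by (simp add: divide_inverse mult.commute)
  \<comment> \<open>The expansion of a dual vector contains that vector with coefficient 1, so the
    multiples of \<open>X\<close> and \<xi> in it add up to zero; applying \<open>f\<close> to them
    leaves \<open>f u\<close>.\<close>
  have "f u = 0" if "u = f u *\<^sub>R X + u + e *\<^sub>R \<xi>" for u e
  proof -
    have "f (f u *\<^sub>R X + e *\<^sub>R \<xi>) = f u"
      by (simp add: linear_add[OF lin] linear_scale[OF lin] fX \<open>f \<xi> = 0\<close>)
    moreover have "f u *\<^sub>R X + e *\<^sub>R \<xi> = 0" using that by (simp add: algebra_simps)
    ultimately show ?thesis by (simp add: linear_0[OF lin])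
  qed
  note fu = this
  have "f u2 = 0" "f u3 = 0" "f u4 = 0"
    using fu[of u2 "k u2"] fu[of u3 "k u3"] fu[of u4 "k u4"] ex[of u2] ex[of u3] ex[of u4]
    by (simp_all add: u fa)
  show ?thesis
    by (rule that[OF u fX \<open>f u2 = 0\<close> \<open>f u3 = 0\<close> \<open>f u4 = 0\<close> \<open>f \<xi> = 0\<close> ex[folded fa]
        A[folded fa l] B[folded fa l] C[folded fa l]])
qed

end

section \<open>The exterior derivative on a product with an interval\<close>

definition skip :: "nat \<Rightarrow> (nat \<Rightarrow> 'v) \<Rightarrow> nat \<Rightarrow> 'v" where
  "skip i v = (\<lambda>j. if j < i then v j else v (Suc j))"

text \<open>The simplicial identity for deleting two entries: the later index drops by one if the
  earlier entry is removed first.\<close>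

lemma skip_skip: "i \<le> j \<Longrightarrow> skip i (skip (Suc j) v) = skip j (skip i v)"
  by (auto simp: skip_def fun_eq_iff)

lemma comp_skip: "(\<lambda>l. f (skip i v l)) = skip i (\<lambda>l. f (v l))"
  by (auto simp: skip_def fun_eq_iff)

lemma skip_case_nat: "skip 0 (case_nat a h) = h"
  by (auto simp: skip_def fun_eq_iff)

lemma ext_d_skip: "ext_d k \<alpha> c x v =
    (\<Sum>i\<le>k. (-1) ^ i * frechet_derivative (\<lambda>y. \<alpha> c y (skip i v)) (at x) (v i))"
  unfolding ext_d_def skip_def ..

text \<open>\<open>(i, j)\<close> stands for the removal of entry \<open>i\<close> and then of entry \<open>j\<close> of the rest. The
  involution removes the same two entries in the other order.\<close>

lemma sum_skip_swap:
  fixes G :: "nat \<Rightarrow> nat \<Rightarrow> 'b::comm_monoid_add"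
  shows "(\<Sum>i\<le>Suc m. \<Sum>j\<le>m. G i j) =
    (\<Sum>i\<le>Suc m. \<Sum>j\<le>m. if j < i then G j (i - 1) else G (Suc j) i)"
  unfolding sum.cartesian_product
  by (rule sum.reindex_bij_witness[where i = "\<lambda>(i, j). if j < i then (j, i - 1) else (Suc j, i)"
        and j = "\<lambda>(i, j). if j < i then (j, i - 1) else (Suc j, i)"]) auto

lemma frechet_derivative_Pair:
  fixes f :: "'v::euclidean_space \<times> real \<Rightarrow> real"
  assumes "f differentiable (at (x, t))"
  shows "frechet_derivative f (at (x, t)) (h, s) =
    frechet_derivative (\<lambda>y. f (y, t)) (at x) h + s * vector_derivative (\<lambda>s. f (x, s)) (at t)"
proof -
  define D where "D = frechet_derivative f (at (x, t))"
  have D: "(f has_derivative D) (at (x, t))"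
    using assms frechet_derivative_works unfolding D_def by blast
  have "((\<lambda>y. f (y, t)) has_derivative (\<lambda>h. D (h, 0))) (at x)"
    using has_derivative_compose[OF has_derivative_Pair[OF has_derivative_ident
      has_derivative_const] D] .
  note d0 = frechet_derivative_at[OF this]
  have 1: "D (h, 0) = frechet_derivative (\<lambda>y. f (y, t)) (at x) h"
    unfolding d0[symmetric] ..
  have lin: "linear D" using has_derivative_linear[OF D] .
  have "((\<lambda>s. f (x, s)) has_derivative (\<lambda>s. D (0, s))) (at t)"
    using has_derivative_compose[OF has_derivative_Pair[OF has_derivative_const
      has_derivative_ident] D] .
  moreover have eq: "(\<lambda>s. D (0, s)) = (\<lambda>s. s *\<^sub>R D (0, 1))"
  proof
    fix s
    have "(0, s) = s *\<^sub>R (0 :: 'v, 1 :: real)" by simp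
    then show "D (0, s) = s *\<^sub>R D (0, 1)"
      by (subst \<open>(0, s) = _\<close>, intro linear_scale[OF lin])
  qed
  ultimately have "((\<lambda>s. f (x, s)) has_vector_derivative D (0, 1)) (at t)"
    unfolding has_vector_derivative_def by (simp only:)
  then have 2: "vector_derivative (\<lambda>s. f (x, s)) (at t) = D (0, 1)"
    by (rule vector_derivative_at)
  have "D (h, s) = D (h, 0) + D (0, s)"
    using linear_add[OF lin, of "(h, 0)" "(0, s)"] by simp
  also have "D (0, s) = s * D (0, 1)"
    using fun_cong[OF eq, of s] by (simp only: real_scaleR_def)
  finally show ?thesis
    unfolding 2 1[symmetric] by (simp only: D_def)
qed

text \<open>This is \<open>A + B \<and> dt\<close> for families \<open>A\<close> of \<open>(m + 1)\<close>-forms and \<open>B\<close> of \<open>m\<close>-forms.\<close>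

definition plus_wedge_dt ::
    "nat \<Rightarrow> (real \<Rightarrow> ('i, 'v, real) dform) \<Rightarrow> (real \<Rightarrow> ('i, 'v, real) dform) \<Rightarrow> ('i, 'v \<times> real, real)
      dform" where
  "plus_wedge_dt m A B = (\<lambda>c (x, t) v. A t c x (\<lambda>i. fst (v i)) +
     (\<Sum>j\<le>m. (-1) ^ (m + j) * snd (v j) * B t c x (skip j (\<lambda>i. fst (v i)))))"

text \<open>Each derivative splits into a space part and a time part. The space part of
  \<open>A\<close> gives its differential on \<open>N\<close>, the time part of \<open>A\<close>
  gives a multiple of dt, the space part of \<open>B\<close> regroups to its differential wedged
  with dt, and the time part of \<open>B\<close> meets dt twice. The sign in front of
  \<open>snd (v i)\<close> moves slot \<open>i\<close> to the end, where dt stands.\<close>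

lemma ext_d_plus_wedge_dt:
  fixes A B :: "real \<Rightarrow> ('i, 'v::euclidean_space, real) dform"
  assumes A: "\<And>w. (\<lambda>(x, t). A t c x w) differentiable (at (x, t))"
    and B: "\<And>w. (\<lambda>(x, t). B t c x w) differentiable (at (x, t))"
  shows "ext_d (Suc m) (plus_wedge_dt m A B) c (x, t) v = ext_d (Suc m) (A t) c x (\<lambda>i. fst (v i)) +
    (\<Sum>i\<le>Suc m. (-1) ^ (Suc m + i) * snd (v i) * (ext_d m (B t) c x (skip i (\<lambda>i. fst (v i)))
       + (-1) ^ Suc m * time_deriv A t c x (skip i (\<lambda>i. fst (v i)))))"
proof -
  define h where "h = (\<lambda>i. fst (v i))"
  define s where "s = (\<lambda>i. snd (v i))"
  define DA DB where "DA w = frechet_derivative (\<lambda>y. A t c y w) (at x)"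
    and "DB w = frechet_derivative (\<lambda>y. B t c y w) (at x)" for w
  define At Bt where "At w = time_deriv A t c x w" and "Bt w = time_deriv B t c x w" for w
  have dA: "((\<lambda>(x, t). A t c x w) has_derivative (\<lambda>u. DA w (fst u) + snd u * At w)) (at (x, t))" for w
    using A[of w, unfolded frechet_derivative_works] frechet_derivative_Pair[OF A[of w]]
    unfolding DA_def At_def time_deriv_def by (simp add: has_derivative_eq_rhs fun_eq_iff
      split_paired_all)
  have dB: "((\<lambda>(x, t). B t c x w) has_derivative (\<lambda>u. DB w (fst u) + snd u * Bt w)) (at (x, t))" for w
    using B[of w, unfolded frechet_derivative_works] frechet_derivative_Pair[OF B[of w]]
    unfolding DB_def Bt_def time_deriv_def by (simp add: has_derivative_eq_rhs fun_eq_iff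
      split_paired_all)
  have "((\<lambda>y. plus_wedge_dt m A B c y w) has_derivative
      (\<lambda>u. (DA (\<lambda>i. fst (w i)) (fst u) + snd u * At (\<lambda>i. fst (w i))) +
        (\<Sum>j\<le>m. (-1) ^ (m + j) * snd (w j) * (DB (skip j (\<lambda>i. fst (w i))) (fst u)
          + snd u * Bt (skip j (\<lambda>i. fst (w i)))))))
      (at (x, t))" for w
    unfolding plus_wedge_dt_def case_prod_beta'
    by (intro has_derivative_add has_derivative_sum has_derivative_mult_right dA[unfolded
      case_prod_beta'] dB[unfolded case_prod_beta'])
  from frechet_derivative_at[OF this, symmetric]
  have "ext_d (Suc m) (plus_wedge_dt m A B) c (x, t) v =
    (\<Sum>i\<le>Suc m. (-1) ^ i * ((DA (skip i h) (h i) + s i * At (skip i h)) +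
        (\<Sum>j\<le>m. (-1) ^ (m + j) * skip i s j * (DB (skip j (skip i h)) (h i)
          + s i * Bt (skip j (skip i h))))))"
    by (simp add: ext_d_skip comp_skip[of fst, folded h_def] h_def s_def comp_skip[of snd, symmetric])
  also have "\<dots> = (\<Sum>i\<le>Suc m. (-1) ^ i * DA (skip i h) (h i))
    + (\<Sum>i\<le>Suc m. (-1) ^ i * s i * At (skip i h))
      + (\<Sum>i\<le>Suc m. \<Sum>j\<le>m. (-1) ^ (i + (m + j)) * skip i s j * DB (skip j (skip i h)) (h i))
      + (\<Sum>i\<le>Suc m. \<Sum>j\<le>m. (-1) ^ (i + (m + j)) * skip i s j * s i * Bt (skip j (skip i h)))"
    unfolding sum.distrib[symmetric]
    by (intro sum.cong refl) (simp add: sum_distrib_left distrib_left power_add mult.assoc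
      sum.distrib)
  \<comment> \<open>The dt \<and> dt term: exchanging the order of the two deletions keeps the
    product of time components and reverses the sign.\<close>
  also have "(\<Sum>i\<le>Suc m. \<Sum>j\<le>m. (-1) ^ (i + (m + j)) * skip i s j * s i * Bt (skip j (skip i h)))
    = 0" (is "?U = 0")
  proof -
    have "?U = - ?U"
      unfolding sum_negf[symmetric]
    proof (subst sum_skip_swap, intro sum.cong refl)
      fix i j assume "i \<in> {..Suc m}" "j \<in> {..m}"
      show "(if j < i then (-1) ^ (j + (m + (i - 1))) * skip j s (i - 1) * s j * Bt (skip (i
        - 1) (skip j h))
          else (-1) ^ (Suc j + (m + i)) * skip (Suc j) s i * s (Suc j) * Bt (skip i (skip (Suc j)
            h))) =
        - ((-1) ^ (i + (m + j)) * skip i s j * s i * Bt (skip j (skip i h)))"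
      proof (cases "j < i")
        case True
        then obtain l where "i = Suc l" "j \<le> l" by (cases i) auto
        then show ?thesis by (simp add: skip_def[of _ s] skip_skip power_add)
      qed (simp add: skip_def[of _ s] skip_skip power_add)
    qed
    then show ?thesis by simp
  qed
  \<comment> \<open>So far the direction of differentiation is deleted first and the slot of dt
    second. In the other order the inner sum is the differential of \<open>B\<close> on the
    remaining vectors.\<close>
  also have "(\<Sum>i\<le>Suc m. \<Sum>j\<le>m. (-1) ^ (i + (m + j)) * skip i s j * DB (skip j (skip i h)) (h i)) =
     (\<Sum>i\<le>Suc m. \<Sum>j\<le>m. (-1) ^ (Suc m + i) * s i * ((-1) ^ j * DB (skip j (skip i h)) (skip i h j)))"
  proof (subst sum_skip_swap, intro sum.cong refl)
    fix i j assume "i \<in> {..Suc m}" "j \<in> {..m}"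
    have sk: "skip p h q = (if q < p then h q else h (Suc q))" for p q by (simp add: skip_def)
    show "(if j < i then (-1) ^ (j + (m + (i - 1))) * skip j s (i - 1) * DB (skip (i
      - 1) (skip j h)) (h j)
        else (-1) ^ (Suc j + (m + i)) * skip (Suc j) s i * DB (skip i (skip (Suc j) h)) (h (Suc j))) =
      (-1) ^ (Suc m + i) * s i * ((-1) ^ j * DB (skip j (skip i h)) (skip i h j))"
    proof (cases "j < i")
      case True
      then obtain l where "i = Suc l" "j \<le> l" by (cases i) auto
      then show ?thesis by (simp add: skip_def[of _ s] sk skip_skip power_add)
    qed (simp add: skip_def[of _ s] sk skip_skip power_add)
  qed
  also have "\<dots> = (\<Sum>i\<le>Suc m. (-1) ^ (Suc m + i) * s i * ext_d m (B t) c x (skip i h))"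
    by (simp add: sum_distrib_left ext_d_skip DB_def)
  finally have "ext_d (Suc m) (plus_wedge_dt m A B) c (x, t) v = ext_d (Suc m) (A t) c x h
      + (\<Sum>i\<le>Suc m. (-1) ^ (Suc m + i) * s i * ext_d m (B t) c x (skip i h)
        + (-1) ^ i * s i * At (skip i h))"
    unfolding ext_d_skip[of "Suc m" "A t"] DA_def sum.distrib by linarith
  moreover have "p * q * s * b + q * s * a = p * q * s * (b + p * a)" if "p * p = 1"
    for p q s a b :: real
  proof -
    have "p * q * s * (b + p * a) = p * q * s * b + (p * p) * q * s * a" by algebra
    then show ?thesis using that by simp
  qed
  from this[of "(-1) ^ Suc m"] have "(-1) ^ (Suc m + i) * s i * b + (-1) ^ i * s i * a =
      (-1) ^ (Suc m + i) * s i * (b + (-1) ^ Suc m * a)" for i a b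
    unfolding power_add by (simp flip: power_mult_distrib)
  ultimately show ?thesis
    unfolding h_def[symmetric] s_def[symmetric, THEN fun_cong] At_def by (simp only: s_def)
qed

section \<open>Forms on the product manifold\<close>

lemma smooth_manifoldD:
  assumes "smooth_manifold N" "c \<in> charts N"
  shows "open (coord_range N c)" "openin (points N) (patch N c)" "inj_on (coord N c) (patch N c)"
    "homeomorphic_map (subtopology (points N) (patch N c)) (top_of_set (coord_range N c)) (coord N c)"
    "c' \<in> charts N \<Longrightarrow> smooth_on (overlap N c c') (transition N c c')"
    "c' \<in> charts N \<Longrightarrow> open (overlap N c c')"
proof -
  show op: "open (coord_range N c)" and pa: "openin (points N) (patch N c)"
    and hm: "homeomorphic_map (subtopology (points N) (patch N c)) (top_of_set (coord_range N c))
        (coord N c)"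
    and "c' \<in> charts N \<Longrightarrow> smooth_on (overlap N c c') (transition N c c')"
    using assms unfolding smooth_manifold_def by auto
  have "topspace (subtopology (points N) (patch N c)) = patch N c"
    using openin_subset[OF pa] by auto
  then show "inj_on (coord N c) (patch N c)"
    using homeomorphic_imp_injective_map[OF hm] by simp
  assume c': "c' \<in> charts N"
  then have "openin (points N) (patch N c')" using assms(1) unfolding smooth_manifold_def by auto
  then have "openin (subtopology (points N) (patch N c)) (patch N c \<inter> patch N c')"
    by (simp add: openin_subtopology_Int2)
  then have "openin (top_of_set (coord_range N c)) (overlap N c c')"
    unfolding overlap_def using homeomorphic_imp_open_map[OF hm] unfolding open_map_def by blast
  then show "open (overlap N c c')"
    using op openin_open_eq by blast
qed

section \<open>The atlas of the product\<close>

lemma coord_range_times_interval: "coord_range (times_interval N I) c = coord_range N c \<times> I"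
  by (force simp: coord_range_def times_interval_def)

lemma overlap_times_interval: "overlap (times_interval N I) c c' = overlap N c c' \<times> I"
  by (force simp: overlap_def times_interval_def)

lemma charts_times_interval: "charts (times_interval N I) = charts N"
  by (simp add: times_interval_def)

lemma transition_times_interval:
  assumes N: "smooth_manifold N" "c \<in> charts N" and x: "x \<in> coord_range N c" and t: "t \<in> I"
  shows "transition (times_interval N I) c c' (x, t) = (transition N c c' x, t)"
proof -
  obtain p where p: "p \<in> patch N c" "x = coord N c p" using x unfolding coord_range_def by auto
  note inj = smooth_manifoldD(3)[OF N]
  have inj': "inj_on (coord (times_interval N I) c) (patch (times_interval N I) c)"
    using inj by (auto simp: inj_on_def times_interval_def)
  have "inv_into (patch (times_interval N I) c) (coord (times_interval N I) c) (x, t) = (p, t)"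
    by (rule inv_into_f_eq[OF inj']) (use p t in \<open>auto simp: times_interval_def\<close>)
  moreover have "inv_into (patch N c) (coord N c) x = p"
    using inv_into_f_eq[OF inj p(1)] p(2) by simp
  ultimately show ?thesis by (simp add: transition_def times_interval_def)
qed

lemma overlap_subset: "overlap N c c' \<subseteq> coord_range N c"
  by (auto simp: overlap_def coord_range_def)

lemma smooth_manifold_times_interval:
  fixes N :: "('i, 'a, 'v::euclidean_space) atlas"
  assumes N: "smooth_manifold N" and I: "open I"
  shows "smooth_manifold (times_interval N I)"
  unfolding smooth_manifold_def
proof (intro conjI ballI)
  let ?M = "times_interval N I"
  have pts: "points ?M = prod_topology (points N) (top_of_set I)" by (simp add: times_interval_def)
  have patch: "patch ?M c = patch N c \<times> I" for c by (simp add: times_interval_def)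
  show "Hausdorff_space (points ?M)"
    using N unfolding pts smooth_manifold_def
    by (simp add: Hausdorff_space_prod_topology Hausdorff_space_subtopology)
  obtain \<B> where \<B>: "countable \<B>" "\<forall>B\<in>\<B>. openin (points N) B"
    "\<And>U x. openin (points N) U \<and> x \<in> U \<Longrightarrow> \<exists>B\<in>\<B>. x \<in> B \<and> B \<subseteq> U"
    using N unfolding smooth_manifold_def by metis
  obtain \<R> :: "real set set" where \<R>: "countable \<R>" "topological_basis \<R>"
    using ex_countable_basis by auto
  \<comment> \<open>Open rectangles from countable bases of both factors; the second side is cut
    down to \<open>I\<close> because the topology there is that of the subspace.\<close>
  let ?\<P> = "(\<lambda>(B, R). B \<times> (I \<inter> R)) ` (\<B> \<times> \<R>)"
  show "\<exists>\<B>. countable \<B> \<and> (\<forall>B\<in>\<B>. openin (points ?M) B) \<and>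
      (\<forall>U x. openin (points ?M) U \<and> x \<in> U \<longrightarrow> (\<exists>B\<in>\<B>. x \<in> B \<and> B \<subseteq> U))"
  proof (intro exI[of _ ?\<P>] conjI allI impI)
    show "countable ?\<P>" using \<B>(1) \<R>(1) by auto
    show "\<forall>B\<in>?\<P>. openin (points ?M) B"
      using \<B>(2) topological_basis_open[OF \<R>(2)] by (auto simp: pts openin_prod_Times_iff)
    fix U z assume "openin (points ?M) U \<and> z \<in> U"
    then obtain A T where AT: "openin (points N) A" "openin (top_of_set I) T" "fst z \<in> A"
      "snd z \<in> T" "A \<times> T \<subseteq> U"
      unfolding pts openin_prod_topology_alt by (metis prod.collapse)
    obtain B where B: "B \<in> \<B>" "fst z \<in> B" "B \<subseteq> A" using \<B>(3) AT by metis
    have "open T" "T \<subseteq> I" using AT(2) I openin_open_eq openin_subset by force+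
    obtain R where R: "R \<in> \<R>" "snd z \<in> R" "R \<subseteq> T"
      using topological_basisE[OF \<R>(2) \<open>open T\<close> AT(4)] by metis
    show "\<exists>B\<in>?\<P>. z \<in> B \<and> B \<subseteq> U"
      by (rule bexI[of _ "B \<times> (I \<inter> R)"]) (use B R AT \<open>T \<subseteq> I\<close> in \<open>auto simp: mem_Times_iff\<close>)
  qed
  have "(\<Union>c\<in>charts N. patch N c) = topspace (points N)"
    using N unfolding smooth_manifold_def by blast
  then show "(\<Union>c\<in>charts ?M. patch ?M c) = topspace (points ?M)"
    unfolding patch pts charts_times_interval by auto
  fix c assume "c \<in> charts ?M"
  then have c: "c \<in> charts N" by (simp add: times_interval_def)
  note Nc = smooth_manifoldD[OF N c]
  show "openin (points ?M) (patch ?M c)"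
    unfolding pts patch openin_prod_Times_iff using Nc(2) by simp
  show "open (coord_range ?M c)"
    unfolding coord_range_times_interval using Nc(1) I by (rule open_Times)
  obtain g where g: "homeomorphic_maps (subtopology (points N) (patch N c)) (top_of_set (coord_range
    N c)) (coord N c) g"
    using Nc(4) homeomorphic_map_maps by blast
  have "homeomorphic_maps (top_of_set I) (top_of_set I) (\<lambda>t. t) (\<lambda>t. t)"
    by (auto simp: homeomorphic_maps_def)
  with g have "homeomorphic_maps (prod_topology (subtopology (points N) (patch N c)) (top_of_set I))
      (prod_topology (top_of_set (coord_range N c)) (top_of_set I)) (\<lambda>(p, t). (coord N c p, t))
        (\<lambda>(x, t). (g x, t))"
    by (subst homeomorphic_maps_prod) blast
  moreover have "prod_topology (subtopology (points N) (patch N c)) (top_of_set I)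
    = subtopology (points ?M) (patch ?M c)"
    using subtopology_Times[of "points N" "top_of_set I"
      "patch N c" I] by (simp add: pts patch subtopology_subtopology)
  moreover have "prod_topology (top_of_set (coord_range N c)) (top_of_set I)
    = top_of_set (coord_range ?M c)"
    using subtopology_Times[of "euclidean :: 'v topology" "euclidean :: real topology"
      "coord_range N c" I]
    by (simp add: coord_range_times_interval)
  ultimately show "homeomorphic_map (subtopology (points ?M) (patch ?M c)) (top_of_set (coord_range
    ?M c)) (coord ?M c)"
    using homeomorphic_map_maps by (auto simp: times_interval_def)
  fix c' assume "c' \<in> charts ?M"
  then have c': "c' \<in> charts N" by (simp add: times_interval_def)
  have op: "open (overlap N c c' \<times> I)" using Nc(6)[OF c'] I by (rule open_Times)
  have "smooth_on (overlap N c c' \<times> I) (\<lambda>z. (transition N c c' (fst z), snd z))"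
    by (intro smooth_on_Pair[OF op] smooth_on_comp_linear[OF op bounded_linear_fst _ Nc(5)[OF c']]
        smooth_on_linear[OF op bounded_linear_snd]) auto
  then show "smooth_on (overlap ?M c c') (transition ?M c c')"
    unfolding overlap_times_interval
    by (rule smooth_on_cong[OF op, rotated])
      (use overlap_subset[of N c c'] transition_times_interval[OF N c] in auto)
qed

section \<open>Algebraic operations on differential forms\<close>

lemma smooth_form_on_alt_wedge:
  fixes \<alpha> \<beta> :: "'v::euclidean_space \<Rightarrow> ('v, 'b::real_normed_field) covector"
  assumes "open S" "smooth_form_on S k \<alpha>" "smooth_form_on S l \<beta>"
  shows "smooth_form_on S (k + l) (\<lambda>x. alt_wedge k l (\<alpha> x) (\<beta> x))"
  unfolding smooth_form_on_def alt_wedge_def[of k l, abs_def, symmetric]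
proof (intro conjI ballI allI)
  show "alt_form (k + l) (alt_wedge k l (\<alpha> x) (\<beta> x))" if "x \<in> S" for x
    using assms(2,3) that unfolding smooth_form_on_def by (blast intro: alt_form_alt_wedge)
  show "smooth_on S (\<lambda>x. alt_wedge k l (\<alpha> x) (\<beta> x) v)" for v
    unfolding alt_wedge_def
    by (rule smooth_on_linear_comp[OF assms(1) bounded_linear_divide],
        intro smooth_on_sum smooth_on_mult smooth_on_const assms(1))
      (use assms(2,3) in \<open>auto simp: smooth_form_on_def\<close>)
qed

lemma diff_form_wedge:
  fixes M :: "('i, 'a, 'v::euclidean_space) atlas" and \<alpha> \<beta> :: "('i, 'v, 'b::real_normed_field) dform"
  assumes "smooth_manifold M" "diff_form M k \<alpha>" "diff_form M l \<beta>"
  shows "diff_form M (k + l) (wedge k l \<alpha> \<beta>)"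
  unfolding diff_form_def
proof (intro conjI ballI)
  show "smooth_form_on (coord_range M c) (k + l) (wedge k l \<alpha> \<beta> c)" if "c \<in> charts M" for c
    using assms(2,3) smooth_manifoldD(1)[OF assms(1) that] that
    unfolding diff_form_def wedge_def by (blast intro: smooth_form_on_alt_wedge)
  show "wedge k l \<alpha> \<beta> c x = pullback (transition M c c') (wedge k l \<alpha> \<beta> c') x"
    if "c \<in> charts M" "c' \<in> charts M" "x \<in> overlap M c c'" for c c' x
  proof -
    have "\<alpha> c x = pullback (transition M c c') (\<alpha> c') x"
      "\<beta> c x = pullback (transition M c c') (\<beta> c') x"
      using assms(2,3) that unfolding diff_form_def by blast+
    then show ?thesis
      unfolding wedge_def by (simp add: pullback_def alt_wedge_def comp_def)
  qed
qed

text \<open>Near \<open>(x, t)\<close> the transition map is the product of the one of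
  \<open>N\<close> with the identity. This makes \<open>on_product\<close> and \<open>dt\<close>
  compatible with changes of chart.\<close>

lemma frechet_derivative_transition_times_interval:
  assumes N: "smooth_manifold N" "c \<in> charts N" "c' \<in> charts N" and I: "open I"
    and x: "x \<in> overlap N c c'" and t: "t \<in> I"
  shows "frechet_derivative (transition (times_interval N I) c c') (at (x, t)) =
    (\<lambda>(h, s). (frechet_derivative (transition N c c') (at x) h, s))"
proof -
  note Nc = smooth_manifoldD[OF N(1,2)]
  define D where "D = frechet_derivative (transition N c c') (at x)"
  have D: "(transition N c c' has_derivative D) (at x)"
    using smooth_onD(1)[OF Nc(5)[OF N(3)] x] unfolding D_def frechet_derivative_works .
  have op: "open (overlap N c c' \<times> I)" using Nc(6)[OF N(3)] I by (rule open_Times)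
  have "((\<lambda>z. (transition N c c' (fst z), snd z)) has_derivative (\<lambda>z. (D (fst z), snd z))) (at (x,
    t))"
    by (intro has_derivative_Pair has_derivative_compose[where g = "transition N c c'" and f = fst]
        bounded_linear_imp_has_derivative bounded_linear_fst bounded_linear_snd) (simp add: D)
  then have "(transition (times_interval N I) c c' has_derivative (\<lambda>z. (D (fst z), snd z))) (at (x,
    t))"
    by (rule has_derivative_transform_within_open[OF _ op])
      (use x t overlap_subset[of N c c'] transition_times_interval[OF N(1,2)] in auto)
  from frechet_derivative_at[OF this] show ?thesis by (auto simp: D_def fun_eq_iff)
qed

lemma alt_form_compose_linear:
  assumes "alt_form k f" "linear L"
  shows "alt_form k (\<lambda>v. f (\<lambda>i. L (v i)))"
  unfolding alt_form_def
proof (intro conjI allI impI)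
  show "f (\<lambda>i. L (v i)) = f (\<lambda>i. L (w i))" if "\<forall>i<k. v i = w i" for v w
    by (rule alt_formD(1)[OF assms(1)]) (use that in simp)
  show "linear (\<lambda>x. f (\<lambda>j. L ((v(i := x)) j)))" if "i < k" for i v
  proof -
    have "(\<lambda>j. L ((v(i := x)) j)) = (\<lambda>j. L (v j))(i := L x)" for x by auto
    then show ?thesis
      using linear_compose[OF assms(2) alt_formD(2)[OF assms(1) that, of "\<lambda>j. L (v j)"]]
      by (simp add: comp_def)
  qed
  show "f (\<lambda>i. L (v i)) = 0" if "i < k" "j < k" "i \<noteq> j \<and> v i = v j" for i j v
    by (rule alt_formD(3)[OF assms(1) that(1,2)]) (use that(3) in auto)
qed

lemma alt_form_1I: "linear g \<Longrightarrow> alt_form 1 (\<lambda>v. g (v 0))"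
  by (simp add: alt_form_def)

lemma alt_form_add:
  assumes "alt_form k f" "alt_form k g"
  shows "alt_form k (\<lambda>v. f v + g v)"
  unfolding alt_form_def
proof (intro conjI allI impI)
  show "f v + g v = f w + g w" if "\<forall>i<k. v i = w i" for v w
    using alt_formD(1)[OF assms(1), of v w] alt_formD(1)[OF assms(2), of v w] that by simp
  show "linear (\<lambda>x. f (v(i := x)) + g (v(i := x)))" if "i < k" for i v
    by (rule linear_compose_add[OF alt_formD(2)[OF assms(1) that] alt_formD(2)[OF assms(2) that]])
  show "f v + g v = 0" if "i < k" "j < k" "i \<noteq> j \<and> v i = v j" for i j v
    using alt_formD(3)[OF assms(1), of i j v] alt_formD(3)[OF assms(2), of i j v] that by simp
qed

lemma alt_form_complex:
  assumes "alt_form k f" "alt_form k g"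
  shows "alt_form k (\<lambda>v. complex_of_real (f v) + \<i> * complex_of_real (g v))"
proof -
  have "linear (\<lambda>x. complex_of_real (p x) + \<i> * complex_of_real (q x))" if "linear p"
    "linear q" for p q :: "'a \<Rightarrow> real"
    using linear_compose_add[OF linear_compose[OF that(1) bounded_linear.linear[OF
      bounded_linear_of_real]]
        linear_compose[OF linear_compose[OF that(2) bounded_linear.linear[OF bounded_linear_of_real]]
          bounded_linear.linear[OF bounded_linear_mult_right]]]
    by (simp add: comp_def)
  note lin = this
  show ?thesis
    unfolding alt_form_def
  proof (intro conjI allI impI)
    show "complex_of_real (f v) + \<i> * complex_of_real (g v) = complex_of_real (f w)
      + \<i> * complex_of_real (g w)"
      if "\<forall>i<k. v i = w i" for v w
      using alt_formD(1)[OF assms(1), of v w] alt_formD(1)[OF assms(2), of v w] that by simp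
    show "linear (\<lambda>x. complex_of_real (f (v(i := x))) + \<i> * complex_of_real (g (v(i := x))))"
      if "i < k" for i v
      by (rule lin[OF alt_formD(2)[OF assms(1) that] alt_formD(2)[OF assms(2) that]])
    show "complex_of_real (f v) + \<i> * complex_of_real (g v) = 0" if "i < k" "j < k"
      "i \<noteq> j \<and> v i = v j" for i j v
      using alt_formD(3)[OF assms(1), of i j v] alt_formD(3)[OF assms(2), of i j v] that by simp
  qed
qed

lemma diff_form_complex:
  fixes M :: "('i, 'a, 'v::euclidean_space) atlas"
  assumes "smooth_manifold M" "diff_form M k \<alpha>" "diff_form M k \<beta>"
  shows "diff_form M k (complex_form \<alpha> \<beta>)"
  unfolding diff_form_def
proof (intro conjI ballI)
  show "smooth_form_on (coord_range M c) k (complex_form \<alpha> \<beta> c)" if c: "c \<in> charts M" for c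
  proof -
    note op = smooth_manifoldD(1)[OF assms(1) c]
    have "smooth_form_on (coord_range M c) k (\<alpha> c)" "smooth_form_on (coord_range M c) k (\<beta> c)"
      using assms(2,3) c unfolding diff_form_def by auto
    then show ?thesis
      unfolding smooth_form_on_def complex_form_def
      by (auto intro!: alt_form_complex smooth_on_add[OF op] smooth_on_mult[OF op] smooth_on_const
          smooth_on_linear_comp[OF op bounded_linear_of_real])
  qed
  show "complex_form \<alpha> \<beta> c x = pullback (transition M c c') (complex_form \<alpha> \<beta> c') x"
    if "c \<in> charts M" "c' \<in> charts M" "x \<in> overlap M c c'" for c c' x
    using assms(2,3) that unfolding diff_form_def complex_form_def pullback_def by simp
qed

lemma diff_form_add:
  fixes M :: "('i, 'a, 'v::euclidean_space) atlas"
  assumes "smooth_manifold M" "diff_form M k \<alpha>" "diff_form M k \<beta>"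
  shows "diff_form M k (\<lambda>c x v. \<alpha> c x v + \<beta> c x v)"
  unfolding diff_form_def
proof (intro conjI ballI)
  show "smooth_form_on (coord_range M c) k (\<lambda>x v. \<alpha> c x v + \<beta> c x v)" if c: "c \<in> charts M" for c
  proof -
    have "smooth_form_on (coord_range M c) k (\<alpha> c)" "smooth_form_on (coord_range M c) k (\<beta> c)"
      using assms(2,3) c unfolding diff_form_def by auto
    then show ?thesis
      unfolding smooth_form_on_def
      by (intro conjI ballI allI alt_form_add smooth_on_add[OF smooth_manifoldD(1)[OF assms(1) c]])
        simp_all
  qed
  show "(\<lambda>v. \<alpha> c x v + \<beta> c x v) = pullback (transition M c c') (\<lambda>x v. \<alpha> c' x v + \<beta> c' x v) x"
    if "c \<in> charts M" "c' \<in> charts M" "x \<in> overlap M c c'" for c c' x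
    using assms(2,3) that unfolding diff_form_def pullback_def by simp
qed

lemma diff_form_on_product:
  fixes N :: "('i, 'a, 'v::euclidean_space) atlas"
  assumes N: "smooth_manifold N" and I: "open I" and \<alpha>: "smooth_family N I k \<alpha>"
  shows "diff_form (times_interval N I) k (on_product \<alpha>)"
  unfolding diff_form_def charts_times_interval coord_range_times_interval overlap_times_interval
proof (intro conjI ballI)
  fix c assume c: "c \<in> charts N"
  have "alt_form k (on_product \<alpha> c z)" if zI: "z \<in> coord_range N c \<times> I" for z
  proof -
    obtain x t where z: "z = (x, t)" "x \<in> coord_range N c" "t \<in> I" using zI by auto
    then have "alt_form k (\<alpha> t c x)"
      using \<alpha> c unfolding smooth_family_def diff_form_def smooth_form_on_def by blast
    then show ?thesis
      unfolding z(1) on_product_def prod.case by (rule alt_form_compose_linear) (rule linear_fst)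
  qed
  moreover have "smooth_on (coord_range N c \<times> I) (\<lambda>z. on_product \<alpha> c z v)" for v
    using \<alpha> c unfolding smooth_family_def on_product_def by (simp add: case_prod_beta')
  ultimately show "smooth_form_on (coord_range N c \<times> I) k (on_product \<alpha> c)"
    unfolding smooth_form_on_def by blast
  fix c' z assume c': "c' \<in> charts N" and "z \<in> overlap N c c' \<times> I"
  then obtain x t where z: "z = (x, t)" "x \<in> overlap N c c'" "t \<in> I" by auto
  have xr: "x \<in> coord_range N c" using z(2) overlap_subset[of N c c'] by blast
  have "\<alpha> t c x = pullback (transition N c c') (\<alpha> t c') x"
    using \<alpha> c c' z unfolding smooth_family_def diff_form_def by blast
  then show "on_product \<alpha> c z = pullback (transition (times_interval N I) c c') (on_product \<alpha> c') z"
    unfolding pullback_def on_product_def z(1)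
      frechet_derivative_transition_times_interval[OF N c c' I z(2,3)]
      transition_times_interval[OF N c xr z(3)]
    by (simp add: case_prod_beta')
qed

lemma diff_form_dt:
  fixes N :: "('i, 'a, 'v::euclidean_space) atlas"
  assumes N: "smooth_manifold N" and I: "open I"
  shows "diff_form (times_interval N I) 1 dt"
  unfolding diff_form_def charts_times_interval coord_range_times_interval overlap_times_interval
proof (intro conjI ballI)
  fix c assume c: "c \<in> charts N"
  show "smooth_form_on (coord_range N c \<times> I) 1 (dt c)"
    unfolding smooth_form_on_def alt_form_def dt_def
    by (simp add: smooth_on_const linear_snd)
  fix c' z assume c': "c' \<in> charts N" and "z \<in> overlap N c c' \<times> I"
  then obtain x t where z: "z = (x, t)" "x \<in> overlap N c c'" "t \<in> I" by auto
  show "dt c z = pullback (transition (times_interval N I) c c') (dt c') z"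
    unfolding pullback_def dt_def z(1)
      frechet_derivative_transition_times_interval[OF N c c' I z(2,3)]
    by (simp add: case_prod_beta')
qed

section \<open>The adapted coframe\<close>

text \<open>In the basis of \<open>normal_form\<close>, \<open>Y = u\<^sub>3 / \<lambda>\<close> satisfies \<open>i\<^sub>X\<omega>\<^sub>3 = i\<^sub>Y\<omega>\<^sub>1\<close> and \<open>\<omega>\<^sub>2(X, Y) = 1
  / \<lambda>\<close>.\<close>

lemma (in skew_triple) nu_pos:
  assumes D: "det_w X w2 w3 w4 > 0" and nu: "nu X w2 w3 w4 \<noteq> 0"
    and \<xi>: "\<xi> \<noteq> 0" "\<And>y. A \<xi> y = 0" "\<And>y. B \<xi> y = 0" "\<And>y. C \<xi> y = 0"
    and sign: "\<And>Y. (\<And>Z. C X Z = A Y Z) \<Longrightarrow> B X Y \<ge> 0"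
  shows "nu X w2 w3 w4 > 0"
proof -
  define l where "l = nu X w2 w3 w4 / (2 * det_w X w2 w3 w4)"
  have D': "det_w X w2 w3 w4 \<noteq> 0" using D by simp
  obtain u3 where u: "A X u3 = 0" "B X u3 = 1" "C X u3 = 0"
    "num_w X w2 w3 w4 u3 / det_w X w2 w3 w4 = 0"
    and "\<And>Y Z. A Y Z = num_w X w2 w3 w4 Y / det_w X w2 w3 w4 * A X Z
        - num_w X w2 w3 w4 Z / det_w X w2 w3 w4 * A X Y
      + nu X w2 w3 w4 / (2 * det_w X w2 w3 w4) * (B X Y * C X Z - C X Y * B X Z)"
    by (rule normal_form[OF D' \<xi>], rule that) assumption+
  from this(5)[of u3] have A: "A u3 Z = l * C X Z" for Z
    by (simp only: u l_def) simp
  have "l \<noteq> 0" using D nu by (simp add: l_def)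
  have "B X ((1 / l) *\<^sub>R u3) \<ge> 0"
    by (rule sign) (use \<open>l \<noteq> 0\<close> in \<open>simp add: bilin A\<close>)
  then have "l > 0" using \<open>l \<noteq> 0\<close> u by (simp add: bilin)
  with D show ?thesis by (simp add: l_def zero_less_divide_iff)
qed

text \<open>If \<open>f v\<close> were nonzero, the entries of \<open>v\<close> would form a basis.
  Some coordinate of \<xi> in it is nonzero, and putting \<xi> in that place multiplies
  \<open>f v\<close> by the coordinate, although the result has to be zero.\<close>

lemma alt_form_top_eq_0:
  fixes f :: "('v::euclidean_space, real) covector"
  assumes f: "alt_form DIM('v) f" and \<xi>: "\<xi> \<noteq> 0" "\<And>v i. i < DIM('v) \<Longrightarrow> v i = \<xi> \<Longrightarrow> f v = 0"
  shows "f v = 0"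
proof (rule ccontr)
  let ?n = "DIM('v)"
  assume nz: "f v \<noteq> 0"
  have inj: "inj_on v {..<?n}"
    using alt_formD(3)[OF f] nz unfolding inj_on_def by blast
  \<comment> \<open>Cramer's rule: all terms of the combination but the \<open>j\<close>-th repeat
    an entry of \<open>v\<close>.\<close>
  have sub: "f (v(j := (\<Sum>i<?n. c i *\<^sub>R v i))) = c j * f v" if j: "j < ?n" for c j
  proof -
    note lin = alt_formD(2)[OF f j, of v]
    have "f (v(j := (\<Sum>i<?n. c i *\<^sub>R v i))) = (\<Sum>i<?n. c i * f (v(j := v i)))"
      using linear_sum[OF lin, of "\<lambda>i. c i *\<^sub>R v i" "{..<?n}"] linear_scale[OF lin] by simp
    also have "\<dots> = (\<Sum>i<?n. if i = j then c j * f v else 0)"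
    proof (rule sum.cong)
      show "c i * f (v(j := v i)) = (if i = j then c j * f v else 0)" if "i \<in> {..<?n}" for i
        using alt_formD(3)[OF f, of i j "v(j := v i)"] that j by auto
    qed simp
    finally show ?thesis using j by simp
  qed
  let ?S = "v ` {..<?n}"
  have ind: "independent ?S"
  proof
    assume "dependent ?S"
    then obtain u b where u: "b \<in> ?S" "u b \<noteq> 0" "(\<Sum>a\<in>?S. u a *\<^sub>R a) = 0"
      using dependent_finite[of ?S] by auto
    then obtain j where j: "j < ?n" "b = v j" by auto
    have "(\<Sum>i<?n. u (v i) *\<^sub>R v i) = 0"
      using u(3) by (simp add: sum.reindex[OF inj])
    then have "f (v(j := 0)) = u b * f v"
      using sub[OF j(1), of "\<lambda>i. u (v i)"] j(2) by simp
    moreover have "f (v(j := 0)) = 0"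
      using linear_0[OF alt_formD(2)[OF f j(1)]] .
    ultimately show False using nz u(2) by simp
  qed
  have "card ?S = ?n" using card_image[OF inj] by simp
  then have "span ?S = UNIV"
    using dim_eq_card_independent[OF ind] dim_eq_full[of ?S] by simp
  then have "\<xi> \<in> span ?S" by simp
  then obtain u where u: "\<xi> = (\<Sum>a\<in>?S. u a *\<^sub>R a)"
    unfolding span_finite[OF finite_imageI[OF finite_lessThan]] by (rule rangeE)
  have \<xi>_eq: "\<xi> = (\<Sum>i<?n. u (v i) *\<^sub>R v i)"
    unfolding u sum.reindex[OF inj] comp_def ..
  then obtain j where j: "j < ?n" "u (v j) \<noteq> 0"
  proof -
    have "\<exists>j<?n. u (v j) \<noteq> 0"
    proof (rule ccontr)
      assume "\<not> ?thesis"
      then have "(\<Sum>i<?n. u (v i) *\<^sub>R v i) = 0" by (intro sum.neutral) auto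
      with \<xi>_eq \<xi>(1) show False by simp
    qed
    with that show ?thesis by blast
  qed
  have "f (v(j := \<xi>)) = u (v j) * f v"
    using sub[OF j(1), of "\<lambda>i. u (v i)"] \<xi>_eq by simp
  then show False using \<xi>(2)[OF j(1), of "v(j := \<xi>)"] j(2) nz by simp
qed

section \<open>From structures on the manifold to linear algebra at a point\<close>

lemma skew_alt_form: "alt_form 2 f \<Longrightarrow> skew (\<lambda>a b. f (vec2 a b))"
  unfolding skew_def using alt_form_2_alt(2,3) by blast

lemma alt_wedge_2_2_eq_wedge22:
  assumes "alt_form 2 f" "alt_form 2 g"
  shows "alt_wedge 2 2 f g v = wedge22 (\<lambda>a b. f (vec2 a b)) (\<lambda>a b. g (vec2 a b)) (v 0) (v 1) (v 2)
      (v 3)"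
  unfolding alt_wedge_2_2[OF assms] wedge22_def ..

lemma wedge22_eq_alt_wedge:
  assumes "alt_form 2 f" "alt_form 2 g"
  shows "wedge22 (\<lambda>a b. f (vec2 a b)) (\<lambda>a b. g (vec2 a b)) a b c d
      = alt_wedge 2 2 f g (\<lambda>i. [a, b, c, d] ! i)"
  by (simp add: alt_wedge_2_2_eq_wedge22[OF assms])

lemma diff_form_alt_form:
  "diff_form M k \<alpha> \<Longrightarrow> c \<in> charts M \<Longrightarrow> x \<in> coord_range M c \<Longrightarrow> alt_form k (\<alpha> c x)"
  unfolding diff_form_def smooth_form_on_def by simp

text \<open>In odd dimension \<open>\<omega>\<^sub>1\<close> has a kernel vector \<open>\<xi>\<close>, which is then annihilated by all \<open>\<omega>\<^sub>i\<close>. If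
  also \<open>\<eta>(\<xi>) = 0\<close>, then the form \<open>v \<and> \<eta>\<close> of top degree would be annihilated by \<open>\<xi>\<close>, hence zero.\<close>

lemma SU2_structure_pointwise:
  fixes N :: "('i, 'a, real ^ 5) atlas"
  assumes SU2: "SU2_structure N \<eta> \<omega>1 \<omega>2 \<omega>3" and c: "c \<in> charts N" and x: "x \<in> coord_range N c"
  defines "A \<equiv> \<lambda>a b. \<omega>1 c x (vec2 a b)" and "B \<equiv> \<lambda>a b. \<omega>2 c x (vec2 a b)"
    and "C \<equiv> \<lambda>a b. \<omega>3 c x (vec2 a b)"
  shows "skew_triple A B C (wedge22 A A)"
    and "\<exists>p q r s. wedge22 A A p q r s \<noteq> 0"
    and "\<exists>\<xi>. \<xi> \<noteq> 0 \<and> (\<forall>y. A \<xi> y = 0) \<and> (\<forall>y. B \<xi> y = 0) \<and> (\<forall>y. C \<xi> y = 0) \<and> \<eta> c x (\<lambda>_. \<xi>) \<noteq> 0"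
    and "(\<And>Z. C X Z = A Y Z) \<Longrightarrow> B X Y \<ge> 0"
proof -
  have forms: "alt_form 1 (\<eta> c x)" "alt_form 2 (\<omega>1 c x)" "alt_form 2 (\<omega>2 c x)" "alt_form 2 (\<omega>3 c x)"
    using SU2 diff_form_alt_form[OF _ c x] unfolding SU2_structure_def by blast+
  obtain \<nu> where wedges: "\<And>i j. i < 3 \<Longrightarrow> j < 3 \<Longrightarrow> form_eq N (wedge 2 2 ([\<omega>1, \<omega>2, \<omega>3] ! i) ([\<omega>1, \<omega>2,
    \<omega>3] ! j))
        (if i = j then \<nu> else (\<lambda>c x v. 0))"
    and nz: "wedge 4 1 \<nu> \<eta> c x \<noteq> (\<lambda>v. 0)" and \<nu>: "diff_form N 4 \<nu>"
    using SU2 c x unfolding SU2_structure_def by blast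
  have w: "alt_wedge 2 2 (([\<omega>1, \<omega>2, \<omega>3] ! i) c x) (([\<omega>1, \<omega>2, \<omega>3] ! j) c x) = (if i = j then \<nu> c x
    else (\<lambda>v. 0))"
    if "i < 3" "j < 3" for i j
    using wedges[OF that] c x unfolding form_eq_def wedge_def by (auto split: if_splits)
  have w11: "alt_wedge 2 2 (\<omega>1 c x) (\<omega>1 c x) = \<nu> c x"
    and w22: "alt_wedge 2 2 (\<omega>2 c x) (\<omega>2 c x) = \<nu> c x"
    and w33: "alt_wedge 2 2 (\<omega>3 c x) (\<omega>3 c x) = \<nu> c x"
    and w12: "alt_wedge 2 2 (\<omega>1 c x) (\<omega>2 c x) = (\<lambda>v. 0)"
        and w13: "alt_wedge 2 2 (\<omega>1 c x) (\<omega>3 c x) = (\<lambda>v. 0)"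
    and w23: "alt_wedge 2 2 (\<omega>2 c x) (\<omega>3 c x) = (\<lambda>v. 0)"
    using w[of 0 0] w[of 1 1] w[of 2 2] w[of 0 1] w[of 0 2] w[of 1 2] by simp_all
  have sk: "skew A" "skew B" "skew C"
    unfolding A_def B_def C_def by (intro skew_alt_form forms)+
  show triple: "skew_triple A B C (wedge22 A A)"
    by unfold_locales
      (use sk in \<open>simp_all add: A_def B_def C_def wedge22_eq_alt_wedge forms w11 w22 w33 w12 w13 w23\<close>)
  have \<nu>_eq: "\<nu> c x v = wedge22 A A (v 0) (v 1) (v 2) (v 3)" for v
    unfolding w11[symmetric] A_def by (rule alt_wedge_2_2_eq_wedge22[OF forms(2,2)])
  show nonzero: "\<exists>p q r s. wedge22 A A p q r s \<noteq> 0"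
  proof (rule ccontr)
    assume "\<not> ?thesis"
    then have "\<nu> c x v = 0" for v unfolding \<nu>_eq by blast
    then have "wedge 4 1 \<nu> \<eta> c x = (\<lambda>v. 0)" by (simp add: wedge_def alt_wedge_def)
    with nz show False by simp
  qed
  have odd: "odd (CARD(5))" by simp
  obtain \<xi> where \<xi>: "\<xi> \<noteq> 0" "\<And>y. A \<xi> y = 0"
    by (rule skew_odd_dim_kernel[OF sk(1) odd], rule that)
  obtain p q r s where pqrs: "wedge22 A A p q r s \<noteq> 0" using nonzero by blast
  have \<xi>B: "B \<xi> y = 0" and \<xi>C: "C \<xi> y = 0" for y
    using kernel_shared[OF sk(1) sk(2) _ pqrs \<xi>(2)] kernel_shared[OF sk(1) sk(3) _ pqrs \<xi>(2)]
      skew_triple.offdiag[OF triple] by blast+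
  have A\<xi>: "A y \<xi> = 0" for y using skew_neg[OF sk(1) \<xi>(2)] by simp
  have "\<eta> c x (\<lambda>_. \<xi>) \<noteq> 0"
  proof
    assume \<eta>: "\<eta> c x (\<lambda>_. \<xi>) = 0"
    from alt_form_alt_wedge[OF diff_form_alt_form[OF \<nu> c x] forms(1)]
    have alt: "alt_form DIM(real ^ 5) (wedge 4 1 \<nu> \<eta> c x)" by (simp add: wedge_def)
    have "wedge 4 1 \<nu> \<eta> c x v = 0" if i: "i < DIM(real ^ 5)" "v i = \<xi>" for v i
    proof -
      \<comment> \<open>Every summand of the wedge product vanishes: \<xi> is fed either to one of
        the first four slots, where the 4-form kills it, or to slot 4, where \<eta> does.\<close>
      have "\<nu> c x (v \<circ> \<sigma>) * \<eta> c x (\<lambda>i. v (\<sigma> (4 + i))) = 0" if \<sigma>: "\<sigma> permutes {..<5}" for \<sigma>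
      proof -
        define j where "j = inv \<sigma> i"
        have j: "\<sigma> j = i" "j < 5"
          using \<sigma> i(1) permutes_inverses(1)[OF \<sigma>] permutes_in_image[OF permutes_inv[OF \<sigma>], of i]
          by (auto simp: j_def)
        consider "j = 0" | "j = 1" | "j = 2" | "j = 3" | "j = 4" using j(2) by linarith
        then show ?thesis
        proof cases
          case 5
          have "\<eta> c x (\<lambda>i. v (\<sigma> (4 + i))) = \<eta> c x (\<lambda>_. \<xi>)"
            by (subst alt_form_1_eq[OF forms(1)]) (use j 5 i in simp)
          then show ?thesis using \<eta> by simp
        qed (use j i in \<open>simp_all add: \<nu>_eq wedge22_def \<xi> A\<xi>\<close>)
      qed
      then have "(\<Sum>\<sigma> | \<sigma> permutes {..<5}. of_int (sign \<sigma>) * \<nu> c x (v \<circ> \<sigma>) * \<eta> c x (\<lambda>i. v (\<sigma> (4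
        + i)))) = 0"
        by (intro sum.neutral) (simp add: mult.assoc)
      then show ?thesis unfolding wedge_def alt_wedge_def by simp
    qed
    then have "wedge 4 1 \<nu> \<eta> c x v = 0" for v
      by (rule alt_form_top_eq_0[OF alt \<xi>(1)])
    with nz show False by blast
  qed
  with \<xi> \<xi>B \<xi>C show "\<exists>\<xi>. \<xi> \<noteq> 0 \<and> (\<forall>y. A \<xi> y = 0) \<and> (\<forall>y. B \<xi> y = 0) \<and> (\<forall>y. C \<xi> y = 0)
    \<and> \<eta> c x (\<lambda>_. \<xi>) \<noteq> 0"
    by blast
  assume CA: "\<And>Z. C X Z = A Y Z"
  have "contract X (\<omega>3 c x) = contract Y (\<omega>1 c x)"
  proof
    fix v
    show "contract X (\<omega>3 c x) v = contract Y (\<omega>1 c x) v"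
      unfolding contract_def alt_form_2_eq[OF forms(4), of "case_nat X v"] alt_form_2_eq[OF
        forms(2), of "case_nat Y v"]
      using CA[of "v 0"] by (simp add: A_def C_def)
  qed
  then show "B X Y \<ge> 0"
    using SU2 c x unfolding SU2_structure_def B_def vec2_def by blast
qed

text \<open>With \<open>e\<^sup>1 = f / r\<close>, \<open>e\<^sup>2 = r \<alpha>\<close>, \<open>e\<^sup>3 = r \<beta>\<close> and \<open>e\<^sup>4 = r \<gamma>\<close>, the coframe is \<open>e\<^sup>1, e\<^sup>4, e\<^sup>2,
  e\<^sup>3, \<eta>, dt\<close>, in this order: if \<open>\<omega>\<^sub>1 = e\<^sup>1\<^sup>2 + e\<^sup>3\<^sup>4\<close>, \<open>\<omega>\<^sub>2 = e\<^sup>1\<^sup>3 + e\<^sup>4\<^sup>2\<close> and \<open>\<omega>\<^sub>3 = e\<^sup>1\<^sup>4 +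
  e\<^sup>2\<^sup>3\<close>, then \<open>\<omega>\<^sub>1 + i\<omega>\<^sub>2 = (e\<^sup>1 + ie\<^sup>4) \<and> (e\<^sup>2 + ie\<^sup>3)\<close>.\<close>

definition adapted_coframe ::
    "('v \<Rightarrow> real) \<Rightarrow> ('v \<Rightarrow> real) \<Rightarrow> ('v \<Rightarrow> real) \<Rightarrow> ('v \<Rightarrow> real) \<Rightarrow> ('v \<Rightarrow> real) \<Rightarrow> real \<Rightarrow> nat \<Rightarrow> ('v \<times> real,
      real) covector" where
  "adapted_coframe f \<alpha> \<beta> \<gamma> \<eta> r i = (\<lambda>v. if i = 1 then f (fst (v 0)) * (1 / r) else
    if i = 2 then r * \<gamma> (fst (v 0))
     else if i = 3 then r * \<alpha> (fst (v 0)) else if i = 4 then r * \<beta> (fst (v 0))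
     else if i = 5 then \<eta> (fst (v 0)) else snd (v 0))"

text \<open>The coordinate \<open>k\<close> along \<xi> is not among the covectors; \<eta> takes its
  place, and \<eta>(\<xi>) being nonzero makes this possible although \<eta> may also be nonzero on
  the other basis vectors.\<close>

lemma one_form_basis_adapted_coframe:
  fixes X u2 u3 u4 \<xi> :: "'v::real_vector"
  assumes lin: "linear f" "linear \<alpha>" "linear \<beta>" "linear \<gamma>" "linear \<eta>"
    and dual: "\<alpha> u2 = 1" "\<beta> u2 = 0" "\<gamma> u2 = 0" "\<alpha> u3 = 0" "\<beta> u3 = 1" "\<gamma> u3 = 0" "\<alpha> u4 = 0"
        "\<beta> u4 = 0" "\<gamma> u4 = 1"
      "f X = 1" "f u2 = 0" "f u3 = 0" "f u4 = 0" "f \<xi> = 0"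
      "\<alpha> X = 0" "\<beta> X = 0" "\<gamma> X = 0" "\<alpha> \<xi> = 0" "\<beta> \<xi> = 0" "\<gamma> \<xi> = 0"
    and ex: "\<And>Y. Y = f Y *\<^sub>R X + \<alpha> Y *\<^sub>R u2 + \<beta> Y *\<^sub>R u3 + \<gamma> Y *\<^sub>R u4 + k Y *\<^sub>R \<xi>"
    and nz: "\<eta> \<xi> \<noteq> 0" "r \<noteq> 0"
  shows "one_form_basis {1..6} (adapted_coframe f \<alpha> \<beta> \<gamma> \<eta> r)"
proof -
  let ?e = "adapted_coframe f \<alpha> \<beta> \<gamma> \<eta> r"
  have S: "(\<Sum>i\<in>{1..6::nat}. h i) = h 1 + h 2 + h 3 + h 4 + h 5 + h 6" for h :: "nat \<Rightarrow> real"
    by (simp add: eval_nat_numeral atLeastAtMostSuc_conv)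
  note e = adapted_coframe_def
  have zero: "f 0 = 0" "\<alpha> 0 = 0" "\<beta> 0 = 0" "\<gamma> 0 = 0" "\<eta> 0 = 0" using lin by (auto simp: linear_0)
  have "alt_form 1 (?e i)" for i
    unfolding alt_form_def
    using lin by (auto simp: e linear_iff algebra_simps)
  moreover have "\<forall>i\<in>{1..6}. a i = 0" if *: "\<forall>v. (\<Sum>i\<in>{1..6}. a i * ?e i v) = 0" for a
  proof -
    \<comment> \<open>The order of evaluation matters: \<open>(\<xi>, 0)\<close> isolates
      \<open>a 5\<close>, and only then do \<open>X, u4, u2, u3\<close> isolate one coefficient
      each.\<close>
    have v: "(\<Sum>i\<in>{1..6}. a i * ?e i (\<lambda>_. p)) = 0" for p using * by blast
    have "a 6 = 0" using v[of "(0, 1)", unfolded S e] by (simp add: zero)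
    moreover have "a 5 = 0" using v[of "(\<xi>, 0)", unfolded S e] nz by (simp add: dual)
    ultimately have "a 1 = 0" "a 2 = 0" "a 3 = 0" "a 4 = 0"
      using v[of "(X, 0)", unfolded S e] v[of "(u4, 0)", unfolded S e] v[of "(u2, 0)", unfolded S e]
        v[of "(u3, 0)", unfolded S e] nz by (simp_all add: dual)
    moreover have "i = 1 \<or> i = 2 \<or> i = 3 \<or> i = 4 \<or> i = 5 \<or> i = 6" if "i \<in> {1..6}" for i :: nat
      using that by auto
    ultimately show ?thesis using \<open>a 5 = 0\<close> \<open>a 6 = 0\<close> by metis
  qed
  moreover have "\<exists>a. \<forall>v. g v = (\<Sum>i\<in>{1..6}. a i * ?e i v)" if g: "alt_form 1 g" for g
  proof -
    define G where "G p = g (\<lambda>_. p)" for p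
    have gG: "g v = G (v 0)" for v
      unfolding G_def by (rule alt_form_1_eq[OF g])
    have "linear (\<lambda>x. g ((\<lambda>_. 0)(0 := x)))" using alt_formD(2)[OF g, of 0] by simp
    then have G: "linear G" unfolding gG by simp
    \<comment> \<open>\<kappa> is the coefficient of \<eta>: the covector \<open>G\<close> minus
      \<kappa> times \<eta> vanishes on \<xi>, so it no longer involves \<open>k\<close>.\<close>
    define \<kappa> where "\<kappa> = G (\<xi>, 0) / \<eta> \<xi>"
    have G_ex: "G (Y, s) = f Y * G (X, 0) + \<alpha> Y * G (u2, 0) + \<beta> Y * G (u3, 0) + \<gamma> Y * G (u4, 0)
      + k Y * G (\<xi>, 0) + s * G (0, 1)" for Y s
    proof -
      have "(Y, s) = f Y *\<^sub>R (X, 0) + \<alpha> Y *\<^sub>R (u2, 0) + \<beta> Y *\<^sub>R (u3, 0) + \<gamma> Y *\<^sub>R (u4, 0)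
        + k Y *\<^sub>R (\<xi>, 0) + s *\<^sub>R (0, 1)"
        using ex[of Y] by simp
      then show ?thesis
        using linear_add[OF G] linear_scale[OF G] by (metis real_scaleR_def)
    qed
    have \<eta>_ex: "\<eta> Y = f Y * \<eta> X + \<alpha> Y * \<eta> u2 + \<beta> Y * \<eta> u3 + \<gamma> Y * \<eta> u4 + k Y * \<eta> \<xi>" for Y
      using arg_cong[OF ex[of Y], of \<eta>] by (simp only: linear_add[OF lin(5)] linear_scale[OF lin(5)]
        real_scaleR_def)
    have \<kappa>: "G (\<xi>, 0) = \<kappa> * \<eta> \<xi>" using nz by (simp add: \<kappa>_def)
    define a where "a i = (if i = 1 then r * (G (X, 0) - \<kappa> * \<eta> X) else
      if i = 2 then (G (u4, 0) - \<kappa> * \<eta> u4) / r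
      else if i = 3 then (G (u2, 0) - \<kappa> * \<eta> u2) / r else if i = 4 then (G (u3, 0) - \<kappa> * \<eta> u3) / r
      else if i = 5 then \<kappa> else G (0, 1))" for i :: nat
    have "g v = (\<Sum>i\<in>{1..6}. a i * ?e i v)" for v
    proof -
      obtain Y s where Y: "v 0 = (Y, s)" by (cases "v 0")
      have "(\<Sum>i\<in>{1..6}. a i * ?e i v) = (G (X, 0) - \<kappa> * \<eta> X) * f Y + (G (u4, 0) - \<kappa> * \<eta> u4) * \<gamma> Y
        + (G (u2, 0) - \<kappa> * \<eta> u2) * \<alpha> Y + (G (u3, 0) - \<kappa> * \<eta> u3) * \<beta> Y + \<kappa> * \<eta> Y + G (0, 1) * s"
        unfolding S using nz(2) by (simp add: a_def e Y)
      also have "\<dots> = G (Y, s)"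
        unfolding G_ex[of Y s] \<eta>_ex[of Y] \<kappa> by algebra
      finally show ?thesis by (simp add: gG Y)
    qed
    then show ?thesis by blast
  qed
  ultimately show ?thesis unfolding one_form_basis_def by blast
qed

lemma smooth_form_on_adapted_coframe:
  fixes f \<alpha> \<beta> \<gamma> \<eta> :: "'v::euclidean_space \<times> real \<Rightarrow> 'v \<Rightarrow> real"
  assumes W: "open W" and alt: "\<And>z. z \<in> W \<Longrightarrow> alt_form 1 (adapted_coframe (f z) (\<alpha> z) (\<beta> z) (\<gamma> z) (\<eta>
      z) (sqrt (l z)) i)"
    and smooth: "\<And>Y. smooth_on W (\<lambda>z. f z Y)" "\<And>Y. smooth_on W (\<lambda>z. \<alpha> z Y)"
        "\<And>Y. smooth_on W (\<lambda>z. \<beta> z Y)"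
      "\<And>Y. smooth_on W (\<lambda>z. \<gamma> z Y)" "\<And>Y. smooth_on W (\<lambda>z. \<eta> z Y)" "smooth_on W l"
    and pos: "\<And>z. z \<in> W \<Longrightarrow> l z > 0"
  shows "smooth_form_on W 1 (\<lambda>z. adapted_coframe (f z) (\<alpha> z) (\<beta> z) (\<gamma> z) (\<eta> z) (sqrt (l z)) i)"
  unfolding smooth_form_on_def
proof (intro conjI ballI allI)
  have r: "smooth_on W (\<lambda>z. sqrt (l z))" "smooth_on W (\<lambda>z. 1 / sqrt (l z))"
    by (rule smooth_on_sqrt[OF W smooth(6) pos] smooth_on_rsqrt[OF W smooth(6) pos], assumption)+
  show "smooth_on W (\<lambda>z. adapted_coframe (f z) (\<alpha> z) (\<beta> z) (\<gamma> z) (\<eta> z) (sqrt (l z)) i v)" for v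
    unfolding adapted_coframe_def
    by (cases "i = 1"; cases "i = 2"; cases "i = 3"; cases "i = 4"; cases "i = 5")
      (simp_all only: simp_thms if_True if_False smooth_on_mult[OF W] smooth r smooth_on_const)
qed (rule alt)

text \<open>In products of the first covector with one of the next three the factors
  \<open>1 / sqrt l\<close> and \<open>sqrt l\<close> cancel; in products of two of those three they
  multiply to \<open>l\<close>.\<close>

lemma SU3_model_adapted_coframe:
  fixes A B C :: "'v::real_vector \<Rightarrow> 'v \<Rightarrow> real"
  assumes alt: "\<And>i. i \<in> {1..6} \<Longrightarrow> alt_form 1 (adapted_coframe f \<alpha> \<beta> \<gamma> \<eta> (sqrt l) i)" and l: "l > 0"
    and A: "\<And>Y Z. A Y Z = f Y * \<alpha> Z - f Z * \<alpha> Y + l * (\<beta> Y * \<gamma> Z - \<gamma> Y * \<beta> Z)"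
    and B: "\<And>Y Z. B Y Z = f Y * \<beta> Z - f Z * \<beta> Y + l * (\<gamma> Y * \<alpha> Z - \<alpha> Y * \<gamma> Z)"
    and C: "\<And>Y Z. C Y Z = f Y * \<gamma> Z - f Z * \<gamma> Y + l * (\<alpha> Y * \<beta> Z - \<beta> Y * \<alpha> Z)"
  defines "e \<equiv> adapted_coframe f \<alpha> \<beta> \<gamma> \<eta> (sqrt l)"
  shows "SU3_model_F e v = C (fst (v 0)) (fst (v 1)) + alt_wedge 1 1 (e 5) (e 6) v"
    and "SU3_model_Psi e = alt_wedge 2 1
      (\<lambda>v. complex_of_real (A (fst (v 0)) (fst (v 1))) + \<i> * complex_of_real (B (fst (v 0)) (fst (v
        1))))
      (\<lambda>v. complex_of_real (e 5 v) + \<i> * complex_of_real (e 6 v))"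
proof -
  have r: "sqrt l \<noteq> 0" "sqrt l * sqrt l = l" using l by auto
  have *: "sqrt l * x * (sqrt l * y) = l * (x * y)" for x y
    using r(2) by (metis mult.assoc mult.left_commute)
  have e: "e 1 v = f (fst (v 0)) * (1 / sqrt l)" "e 2 v = sqrt l * \<gamma> (fst (v 0))"
    "e 3 v = sqrt l * \<alpha> (fst (v 0))"
    "e 4 v = sqrt l * \<beta> (fst (v 0))" for v
    by (simp_all add: e_def adapted_coframe_def)
  have alt': "alt_form 1 (e 1)" "alt_form 1 (e 2)" "alt_form 1 (e 3)" "alt_form 1 (e 4)"
    unfolding e_def by (intro alt; simp)+
  have **: "x * (1 / sqrt l) * (sqrt l * y) = x * y" "sqrt l * y * (x * (1 / sqrt l)) = x * y" for x y
    using r(1) by simp_all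
  show "SU3_model_F e v = C (fst (v 0)) (fst (v 1)) + alt_wedge 1 1 (e 5) (e 6) v"
    unfolding SU3_model_F_def alt_wedge_1_1[OF alt'(1,2)] alt_wedge_1_1[OF alt'(3,4)] e C * **
    by (simp add: algebra_simps)
  have z: "alt_form 1 (\<lambda>v. complex_of_real (e 1 v) + \<i> * complex_of_real (e 2 v))"
    "alt_form 1 (\<lambda>v. complex_of_real (e 3 v) + \<i> * complex_of_real (e 4 v))"
    by (intro alt_form_complex alt')+
  have "alt_wedge 1 1 (\<lambda>v. complex_of_real (e 1 v) + \<i> * complex_of_real (e 2 v))
      (\<lambda>v. complex_of_real (e 3 v) + \<i> * complex_of_real (e 4 v)) v =
    complex_of_real (A (fst (v 0)) (fst (v 1))) + \<i> * complex_of_real (B (fst (v 0)) (fst (v 1)))"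
      for v
  proof -
    have "e 1 (\<lambda>_. v 0) * e 3 (\<lambda>_. v 1) - e 2 (\<lambda>_. v 0) * e 4 (\<lambda>_. v 1)
        - (e 1 (\<lambda>_. v 1) * e 3 (\<lambda>_. v 0) - e 2 (\<lambda>_. v 1) * e 4 (\<lambda>_. v 0)) = A (fst (v 0)) (fst (v 1))"
      "e 1 (\<lambda>_. v 0) * e 4 (\<lambda>_. v 1) + e 2 (\<lambda>_. v 0) * e 3 (\<lambda>_. v 1)
        - (e 1 (\<lambda>_. v 1) * e 4 (\<lambda>_. v 0) + e 2 (\<lambda>_. v 1) * e 3 (\<lambda>_. v 0)) = B (fst (v 0)) (fst (v 1))"
      unfolding e A B * ** by (simp_all add: algebra_simps)
    then show ?thesis
      unfolding alt_wedge_1_1[OF z] complex_eq_iff by simp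
  qed
  then show "SU3_model_Psi e = alt_wedge 2 1
      (\<lambda>v. complex_of_real (A (fst (v 0)) (fst (v 1))) + \<i> * complex_of_real (B (fst (v 0)) (fst (v
        1))))
      (\<lambda>v. complex_of_real (e 5 v) + \<i> * complex_of_real (e 6 v))"
    unfolding SU3_model_Psi_def Let_def by presburger
qed

text \<open>Exchanging the last two vectors reverses the sign of the determinant, so it can be made
  positive, and then \<open>nu_pos\<close> applies. Both conclusions are strict inequalities, so by
  continuity the same vectors remain admissible near the point.\<close>

lemma SU2_structure_admissible_vectors:
  fixes N :: "('i, 'a, real ^ 5) atlas"
  assumes SU2: "SU2_structure N \<eta> \<omega>1 \<omega>2 \<omega>3" and c: "c \<in> charts N" and x: "x \<in> coord_range N c"
  defines "A \<equiv> \<lambda>a b. \<omega>1 c x (vec2 a b)" and "B \<equiv> \<lambda>a b. \<omega>2 c x (vec2 a b)"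
    and "C \<equiv> \<lambda>a b. \<omega>3 c x (vec2 a b)"
  obtains X w2 w3 w4 where "contracted_det A B C X w2 w3 w4 > 0" "wedge22 A A X w2 w3 w4 > 0"
proof -
  note pw = SU2_structure_pointwise[OF SU2 c x]
  interpret skew_triple A B C "wedge22 A A" using pw(1) unfolding A_def B_def C_def .
  have "\<exists>p q r s. wedge22 A A p q r s \<noteq> 0" using pw(2) unfolding A_def .
  then obtain X p q r where nz: "wedge22 A A X p q r \<noteq> 0" by blast
  have swap: "wedge22 A A X p r q = - wedge22 A A X p q r"
    unfolding wedge22_def skew_swap[OF skew(1), of r q] by algebra
  have "\<exists>\<xi>. \<xi> \<noteq> 0 \<and> (\<forall>y. A \<xi> y = 0) \<and> (\<forall>y. B \<xi> y = 0) \<and> (\<forall>y. C \<xi> y = 0) \<and> \<eta> c x (\<lambda>_. \<xi>) \<noteq> 0"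
    using pw(3) unfolding A_def B_def C_def .
  then obtain \<xi> where \<xi>: "\<xi> \<noteq> 0" "\<And>y. A \<xi> y = 0" "\<And>y. B \<xi> y = 0" "\<And>y. C \<xi> y = 0" by blast
  have sign: "B X Y \<ge> 0" if "\<And>Z. C X Z = A Y Z" for X Y
    using pw(4)[of X Y] that unfolding A_def B_def C_def by blast
  have *: "wedge22 A A X u v w > 0" if "det_w X u v w > 0" "wedge22 A A X u v w \<noteq> 0" for u v w
    by (rule nu_pos[OF that \<xi> sign])
  have "det_w X p r q = - det_w X p q r" unfolding contracted_det_def by algebra
  then consider "det_w X p q r > 0" | "det_w X p r q > 0"
    using det_w_nonzero[OF nz] by linarith
  then show ?thesis
  proof cases
    case 1
    show ?thesis by (rule that[OF 1 *[OF 1 nz]])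
  next
    case 2
    have nz': "wedge22 A A X p r q \<noteq> 0" using nz swap by simp
    show ?thesis by (rule that[OF 2 *[OF 2 nz']])
  qed
qed

lemma smooth_family_alt_form:
  assumes "smooth_family N I k \<alpha>" "c \<in> charts N" "x \<in> coord_range N c" "t \<in> I"
  shows "alt_form k (\<alpha> t c x)"
proof -
  have "diff_form N k (\<alpha> t)" using assms(1,4) unfolding smooth_family_def by simp
  then show ?thesis using assms(2,3) by (rule diff_form_alt_form)
qed

lemma SU3_structure_product:
  fixes N :: "('i, 'a, real ^ 5) atlas"
  assumes N: "smooth_manifold N" and I: "open I"
    and fam: "smooth_family N I 1 \<eta>" "smooth_family N I 2 \<omega>1" "smooth_family N I 2 \<omega>2"
        "smooth_family N I 2 \<omega>3"
    and SU2: "\<And>t. t \<in> I \<Longrightarrow> SU2_structure N (\<eta> t) (\<omega>1 t) (\<omega>2 t) (\<omega>3 t)"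
  shows "SU3_structure (times_interval N I) (product_F \<eta> \<omega>3) (product_Psi \<eta> \<omega>1 \<omega>2)"
  unfolding SU3_structure_def
proof (intro conjI ballI)
  let ?M = "times_interval N I"
  show M: "smooth_manifold ?M" by (rule smooth_manifold_times_interval[OF N I])
  show "DIM((real ^ 5) \<times> real) = 6" by simp
  note on = diff_form_on_product[OF N I] and dt = diff_form_dt[OF N I]
  show "diff_form ?M 2 (product_F \<eta> \<omega>3)"
    unfolding product_F_def
    using diff_form_add[OF M on[OF fam(4)] diff_form_wedge[OF M on[OF fam(1)] dt, unfolded
      one_add_one]] .
  show "diff_form ?M 3 (product_Psi \<eta> \<omega>1 \<omega>2)"
    unfolding product_Psi_def
    using diff_form_wedge[OF M diff_form_complex[OF M on[OF fam(2)] on[OF fam(3)]]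
      diff_form_complex[OF M on[OF fam(1)] dt]]
    by simp
  fix c z0 assume "c \<in> charts ?M" and z0: "z0 \<in> coord_range ?M c"
  then have c: "c \<in> charts N" by (simp add: charts_times_interval)
  let ?S = "coord_range N c \<times> I"
  have S: "open ?S" using smooth_manifoldD(1)[OF N c] I by (rule open_Times)
  define A B C where "A = (\<lambda>z a b. \<omega>1 (snd z) c (fst z) (vec2 a b))"
    and "B = (\<lambda>z a b. \<omega>2 (snd z) c (fst z) (vec2 a b))"
        and "C = (\<lambda>z a b. \<omega>3 (snd z) c (fst z) (vec2 a b))"
  note ABC = A_def B_def C_def
  define h where "h = (\<lambda>z a. \<eta> (snd z) c (fst z) (\<lambda>_. a))"
  have smooth: "smooth_on ?S (\<lambda>z. A z a b)" "smooth_on ?S (\<lambda>z. B z a b)" "smooth_on ?S (\<lambda>z. C z a b)"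
    "smooth_on ?S (\<lambda>z. h z a)" for a b
    using fam c unfolding smooth_family_def ABC h_def case_prod_beta' by blast+
  have z0S: "z0 \<in> ?S" using z0 by (simp add: coord_range_times_interval)
  have SU2z: "SU2_structure N (\<eta> (snd z)) (\<omega>1 (snd z)) (\<omega>2 (snd z)) (\<omega>3 (snd z))"
    "fst z \<in> coord_range N c"
    if "z \<in> ?S" for z
    using SU2 that by auto
  note pw = SU2_structure_pointwise[OF SU2z(1) c SU2z(2)]
  obtain X w2 w3 w4 where Xw: "contracted_det (A z0) (B z0) (C z0) X w2 w3 w4 > 0"
    "wedge22 (A z0) (A z0) X w2 w3 w4 > 0"
    using SU2_structure_admissible_vectors[OF SU2z(1)[OF z0S] c SU2z(2)[OF z0S]] unfolding ABC
      by blast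
  define D V where "D z = contracted_det (A z) (B z) (C z) X w2 w3 w4"
    and "V z = wedge22 (A z) (A z) X w2 w3 w4" for z
  define f where "f = (\<lambda>z Y. contracted_num (A z) (B z) (C z) X w2 w3 w4 Y / D z)"
  define l where "l = (\<lambda>z. V z / (2 * D z))"
  have sD: "smooth_on ?S D" and sV: "smooth_on ?S V"
    and sn: "\<And>Y. smooth_on ?S (\<lambda>z. contracted_num (A z) (B z) (C z) X w2 w3 w4 Y)"
    unfolding D_def V_def contracted_det_def wedge22_def contracted_num_def
    by (intro smooth_on_add smooth_on_diff smooth_on_mult smooth S)+
  \<comment> \<open>\<open>X, w2, w3, w4\<close> were chosen at \<open>z0\<close> and stay fixed. On
    \<open>W\<close> the denominator of \<open>f\<close> and \<open>l\<close> is positive, and so is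
    \<open>l\<close>.\<close>
  define W where "W = ?S \<inter> D -` {0<..} \<inter> V -` {0<..}"
  have "open (?S \<inter> D -` {0<..})" "open (?S \<inter> V -` {0<..})"
    by (intro continuous_open_preimage S smooth_onD(2)[OF sD] smooth_onD(2)[OF sV] open_greaterThan)+
  moreover have "W = (?S \<inter> D -` {0<..}) \<inter> (?S \<inter> V -` {0<..})" unfolding W_def by blast
  ultimately have W: "open W" by auto
  have WS: "W \<subseteq> ?S" and D_pos: "\<And>z. z \<in> W \<Longrightarrow> D z > 0" and V_pos: "\<And>z. z \<in> W \<Longrightarrow> V z > 0"
    unfolding W_def by auto
  have l_pos: "l z > 0" if "z \<in> W" for z using D_pos[OF that] V_pos[OF that] by (simp add: l_def)
  note sW = smooth_on_subset[OF _ WS]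
  have "smooth_on W (\<lambda>z. 1 / D z)" by (rule smooth_on_inverse[OF W sW[OF sD] D_pos])
  note sD' = this
  have sf: "smooth_on W (\<lambda>z. f z Y)" for Y
    using smooth_on_mult[OF W sW[OF sn] sD'] unfolding f_def by simp
  have sl: "smooth_on W l"
    using smooth_on_mult[OF W smooth_on_mult[OF W smooth_on_const[of W "1/2"] sW[OF sV]] sD']
      unfolding l_def by simp
  define e where "e i z = adapted_coframe (f z) (A z X) (B z X) (C z X) (h z) (sqrt (l z)) i" for i z
  have *: "one_form_basis {1..6} (\<lambda>i. e i z) \<and> product_F \<eta> \<omega>3 c z = SU3_model_F (\<lambda>i. e i z) \<and>
      product_Psi \<eta> \<omega>1 \<omega>2 c z = SU3_model_Psi (\<lambda>i. e i z)" if z: "z \<in> W" for z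
  proof -
    have zS: "z \<in> ?S" using z WS by blast
    have triple: "skew_triple (A z) (B z) (C z) (wedge22 (A z) (A z))"
      using pw(1)[OF zS zS] unfolding ABC .
    interpret skew_triple "A z" "B z" "C z" "wedge22 (A z) (A z)" by (rule triple)
    \<comment> \<open>\<xi>, and below \<open>u2, u3, u4, k\<close>, are chosen for this
      \<open>z\<close> alone; no dependence on \<open>z\<close> is claimed for them, and
      \<open>e\<close> does not mention them.\<close>
    have "\<exists>\<xi>. \<xi> \<noteq> 0 \<and> (\<forall>y. A z \<xi> y = 0) \<and> (\<forall>y. B z \<xi> y = 0) \<and> (\<forall>y. C z \<xi> y = 0) \<and> h z \<xi> \<noteq> 0"
      using pw(3)[OF zS zS] unfolding ABC h_def .
    then obtain \<xi> where \<xi>: "\<xi> \<noteq> 0" "\<And>y. A z \<xi> y = 0" "\<And>y. B z \<xi> y = 0" "\<And>y. C z \<xi> y = 0" "h z \<xi> \<noteq> 0"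
      by blast
    have Dz: "contracted_det (A z) (B z) (C z) X w2 w3 w4 \<noteq> 0" using D_pos[OF z] by (simp add: D_def)
    have X\<xi>: "A z X \<xi> = 0" "B z X \<xi> = 0" "C z X \<xi> = 0"
      using skew_neg[OF skew(1) \<xi>(2)] skew_neg[OF skew(2) \<xi>(3)] skew_neg[OF skew(3) \<xi>(4)] by simp_all
    have linf: "linear (f z)"
      using linear_compose_scale_right[OF linear_contracted_num[OF skew(2)], of "inverse (D z)"]
      unfolding f_def by (simp add: divide_inverse mult.commute)
    obtain x t where xt: "z = (x, t)" "x \<in> coord_range N c" "t \<in> I" using zS by auto
    have forms: "alt_form 1 (\<eta> t c x)" "alt_form 2 (\<omega>1 t c x)" "alt_form 2 (\<omega>2 t c x)"
      "alt_form 2 (\<omega>3 t c x)"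
      by (intro smooth_family_alt_form[OF fam(1) c xt(2,3)] smooth_family_alt_form[OF fam(2) c
        xt(2,3)]
          smooth_family_alt_form[OF fam(3) c xt(2,3)] smooth_family_alt_form[OF fam(4) c xt(2,3)])+
    have linh: "linear (h z)"
    proof -
      have "h z a = \<eta> t c x ((\<lambda>_. 0)(0 := a))" for a
        unfolding h_def xt by (simp add: alt_form_1_eq[OF forms(1), of "(\<lambda>_. 0)(0 := a)"])
      then show ?thesis using alt_formD(2)[OF forms(1), of 0 "\<lambda>_. 0"] by (simp add: linear_iff)
    qed
    have fz: "contracted_num (A z) (B z) (C z) X w2 w3 w4 Y / contracted_det (A z) (B z) (C z) X w2
      w3 w4 = f z Y" for Y
      by (simp add: f_def D_def)
    have lz: "wedge22 (A z) (A z) X w2 w3 w4 / (2 * contracted_det (A z) (B z) (C z) X w2 w3 w4)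
      = l z"
      by (simp add: l_def D_def V_def)
    obtain u2 u3 u4 k where nf: "A z X u2 = 1" "B z X u2 = 0" "C z X u2 = 0" "A z X u3 = 0"
      "B z X u3 = 1" "C z X u3 = 0"
      "A z X u4 = 0" "B z X u4 = 0" "C z X u4 = 1" "f z X = 1" "f z u2 = 0" "f z u3 = 0"
        "f z u4 = 0" "f z \<xi> = 0"
      and ex: "\<And>Y. Y = f z Y *\<^sub>R X + A z X Y *\<^sub>R u2 + B z X Y *\<^sub>R u3 + C z X Y *\<^sub>R u4 + k Y *\<^sub>R \<xi>"
      and nA: "\<And>Y Z. A z Y Z = f z Y * A z X Z - f z Z * A z X Y + l z * (B z X Y * C z X Z
          - C z X Y * B z X Z)"
      and nB: "\<And>Y Z. B z Y Z = f z Y * B z X Z - f z Z * B z X Y + l z * (C z X Y * A z X Z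
          - A z X Y * C z X Z)"
      and nC: "\<And>Y Z. C z Y Z = f z Y * C z X Z - f z Z * C z X Y + l z * (A z X Y * B z X Z
          - B z X Y * A z X Z)"
      by (rule normal_form[OF Dz \<xi>(1-4), unfolded fz lz], rule that) assumption+
    have basis: "one_form_basis {1..6} (\<lambda>i. e i z)"
      unfolding e_def
      by (rule one_form_basis_adapted_coframe[OF linf skewD(11)[OF skew(1)] skewD(11)[OF skew(2)]
        skewD(11)[OF skew(3)] linh
            nf skewD(1)[OF skew(1)] skewD(1)[OF skew(2)] skewD(1)[OF skew(3)] X\<xi> ex \<xi>(5)])
        (use l_pos[OF z] in simp)
    then have alt: "alt_form 1 (adapted_coframe (f z) (A z X) (B z X) (C z X) (h z) (sqrt (l z)) i)"
      if "i \<in> {1..6}" for i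
      using that unfolding one_form_basis_def e_def by blast
    have "adapted_coframe (f z) (A z X) (B z X) (C z X) (h z) (sqrt (l z)) = (\<lambda>i. e i z)"
      by (simp add: e_def fun_eq_iff)
    note model = SU3_model_adapted_coframe[OF alt l_pos[OF z] nA nB nC, unfolded this]
    have e5: "e 5 z = on_product \<eta> c z"
    proof
      show "e 5 z v = on_product \<eta> c z v" for v
        using alt_form_1_eq[OF forms(1), of "\<lambda>i. fst (v i)"]
        by (simp add: e_def adapted_coframe_def on_product_def h_def xt)
    qed
    have e6: "e 6 z = dt c z" by (simp add: fun_eq_iff e_def adapted_coframe_def dt_def)
    have om: "on_product \<omega> c z v = \<omega> (snd z) c (fst z) (vec2 (fst (v 0)) (fst (v 1)))"
      if "alt_form 2 (\<omega> t c x)" for \<omega> v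
      using alt_form_2_eq[OF that, of "\<lambda>i. fst (v i)"] by (simp add: on_product_def xt)
    have "product_F \<eta> \<omega>3 c z = SU3_model_F (\<lambda>i. e i z)"
    proof
      fix v
      show "product_F \<eta> \<omega>3 c z v = SU3_model_F (\<lambda>i. e i z) v"
        using model(1)[of v] unfolding product_F_def wedge_def e5 e6 om[of \<omega>3, OF forms(4)] C_def
          by simp
    qed
    moreover have "product_Psi \<eta> \<omega>1 \<omega>2 c z = SU3_model_Psi (\<lambda>i. e i z)"
      using model(2) unfolding product_Psi_def wedge_def complex_form_def e5 e6 om[of \<omega>1, OF
        forms(2)] om[of \<omega>2, OF forms(3)] A_def B_def
      by simp
    ultimately show ?thesis using basis by blast
  qed
  have "smooth_form_on W 1 (e i)" if "i \<in> {1..6}" for i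
    unfolding e_def[abs_def]
  proof (rule smooth_form_on_adapted_coframe[OF W _ sf sW[OF smooth(1)] sW[OF smooth(2)] sW[OF
    smooth(3)] sW[OF smooth(4)] sl l_pos])
    show "alt_form 1 (adapted_coframe (f z) (A z X) (B z X) (C z X) (h z) (sqrt (l z)) i)"
      if "z \<in> W" for z
      using *[OF that] \<open>i \<in> {1..6}\<close> unfolding one_form_basis_def e_def by blast
  qed
  moreover have "z0 \<in> W" using Xw z0S unfolding W_def D_def V_def by simp
  ultimately show "\<exists>W e. open W \<and> z0 \<in> W \<and> W \<subseteq> coord_range ?M c \<and>
          (\<forall>i\<in>{1..6}. smooth_form_on W 1 (e i)) \<and>
          (\<forall>y\<in>W. one_form_basis {1..6} (\<lambda>i. e i y) \<and>
             product_F \<eta> \<omega>3 c y = SU3_model_F (\<lambda>i. e i y) \<and> product_Psi \<eta> \<omega>1 \<omega>2 c y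
               = SU3_model_Psi (\<lambda>i. e i y))"
    using * W WS unfolding coord_range_times_interval by (intro exI[of _ W] exI[of _ e]) blast
qed

section \<open>The evolution equations\<close>

lemma ext_d_cong_open:
  assumes "open S" "x \<in> S" "\<And>y. y \<in> S \<Longrightarrow> \<alpha> c y = \<beta> c y"
  shows "ext_d k \<alpha> c x = ext_d k \<beta> c x"
  unfolding ext_d_def using frechet_derivative_cong_open[OF assms(1,2), of "\<lambda>y. \<alpha> c y _"
    "\<lambda>y. \<beta> c y _"] assms(3)
  by simp

lemma ext_d_scale:
  fixes \<alpha> :: "('i, 'v::euclidean_space, real) dform"
  assumes "\<And>w. (\<lambda>y. \<alpha> c y w) differentiable (at x)"
  shows "ext_d k (\<lambda>c x v. r * \<alpha> c x v) c x v = r * ext_d k \<alpha> c x v"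
proof -
  have "frechet_derivative (\<lambda>y. r * \<alpha> c y w) (at x) = (\<lambda>h. r * frechet_derivative (\<lambda>y. \<alpha> c y w) (at
    x) h)" for w
    using frechet_derivative_at[OF has_derivative_mult_right[OF assms[unfolded
      frechet_derivative_works]]] by simp
  then show ?thesis
    unfolding ext_d_def by (simp add: sum_distrib_left mult.left_commute)
qed

text \<open>The two components of the differential are separated by evaluation: on vectors without
  time component only the part on \<open>N\<close> survives, and with the time direction in slot 0
  the factor of dt appears.\<close>

lemma closed_form_plus_wedge_dt_iff:
  fixes N :: "('i, 'a, 'v::euclidean_space) atlas"
  assumes N: "smooth_manifold N" and I: "open I" and k: "k = Suc m"
    and \<Gamma>: "\<And>c x t. c \<in> charts N \<Longrightarrow> x \<in> coord_range N c \<Longrightarrow> t \<in> I \<Longrightarrow> \<Gamma> c (x, t)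
        = plus_wedge_dt m A B c (x, t)"
    and A: "\<And>c x t w. c \<in> charts N \<Longrightarrow> x \<in> coord_range N c \<Longrightarrow> t \<in> I \<Longrightarrow> (\<lambda>(x, t). A t c x w)
        differentiable (at (x, t))"
    and B: "\<And>c x t w. c \<in> charts N \<Longrightarrow> x \<in> coord_range N c \<Longrightarrow> t \<in> I \<Longrightarrow> (\<lambda>(x, t). B t c x w)
        differentiable (at (x, t))"
  shows "closed_form (times_interval N I) k \<Gamma> \<longleftrightarrow> (\<forall>t\<in>I. closed_form N k (A t)) \<and>
    (\<forall>t\<in>I. \<forall>c\<in>charts N. \<forall>x\<in>coord_range N c. \<forall>h. ext_d m (B t) c x h
      + (-1) ^ k * time_deriv A t c x h = 0)"
    (is "?L \<longleftrightarrow> ?R")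
proof -
  let ?E = "\<lambda>t c x h. ext_d m (B t) c x h + (-1) ^ k * time_deriv A t c x h"
  have d: "ext_d k \<Gamma> c (x, t) v = ext_d k (A t) c x (\<lambda>i. fst (v i)) +
    (\<Sum>i\<le>k. (-1) ^ (k + i) * snd (v i) * ?E t c x (skip i (\<lambda>i. fst (v i))))"
    if c: "c \<in> charts N" and x: "x \<in> coord_range N c" and t: "t \<in> I" for c x t v
  proof -
    have op: "open (coord_range N c \<times> I)" using smooth_manifoldD(1)[OF N c] I by (rule open_Times)
    have "ext_d k \<Gamma> c (x, t) = ext_d k (plus_wedge_dt m A B) c (x, t)"
      by (rule ext_d_cong_open[OF op]) (use \<Gamma> c x t in auto)
    then show ?thesis
      unfolding k using ext_d_plus_wedge_dt[where A = A and B = B and c = c and x = x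
        and t = t, OF A[OF c x t] B[OF c x t], of m v] by simp
  qed
  show ?thesis
  proof
    assume L: ?L
    have z: "ext_d k (A t) c x (\<lambda>i. fst (v i)) +
      (\<Sum>i\<le>k. (-1) ^ (k + i) * snd (v i) * ?E t c x (skip i (\<lambda>i. fst (v i)))) = 0"
      if "c \<in> charts N" "x \<in> coord_range N c" "t \<in> I" for c x t v
      using L d[OF that, of v] that
      unfolding closed_form_def form_eq_def charts_times_interval coord_range_times_interval by simp
    have a: "ext_d k (A t) c x h = 0" if "c \<in> charts N" "x \<in> coord_range N c" "t \<in> I" for c x t h
      using z[OF that, of "\<lambda>i. (h i, 0)"] by simp
    moreover have "?E t c x h = 0" if "c \<in> charts N" "x \<in> coord_range N c" "t \<in> I" for c x t h
    proof -
      \<comment> \<open>Only slot 0 has a time component, so the sum reduces to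
        \<open>i = 0\<close>, and deleting slot 0 leaves exactly \<open>h\<close>.\<close>
      let ?v = "case_nat (0, 1 :: real) (\<lambda>i. (h i, 0))"
      have h: "(\<lambda>i. fst (?v i)) = case_nat 0 h" by (auto split: nat.split)
      have "(\<Sum>i\<le>k. (-1) ^ (k + i) * snd (?v i) * ?E t c x (skip i (\<lambda>i. fst (?v i)))) = 0"
        using z[OF that, of ?v] unfolding a[OF that] add_0 .
      also have "(\<Sum>i\<le>k. (-1) ^ (k + i) * snd (?v i) * ?E t c x (skip i (\<lambda>i. fst (?v i)))) =
          (\<Sum>i\<le>k. if i = 0 then (-1) ^ k * ?E t c x h else 0)"
        by (rule sum.cong) (auto simp: h skip_case_nat split: nat.split)
      finally show ?thesis by simp
    qed
    ultimately show ?R unfolding closed_form_def form_eq_def by blast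
  next
    assume R: ?R
    have "ext_d k \<Gamma> c (x, t) v = 0" if "c \<in> charts N" "x \<in> coord_range N c" "t \<in> I" for c x t v
    proof -
      have "ext_d k (A t) c x = (\<lambda>v. 0)" using R that unfolding closed_form_def form_eq_def by blast
      moreover have "?E t c x h = 0" for h using R that by blast
      ultimately show ?thesis unfolding d[OF that] by simp
    qed
    then show ?L
      unfolding closed_form_def form_eq_def charts_times_interval coord_range_times_interval by auto
  qed
qed

section \<open>The three forms of the structure in terms of families on \<open>N\<close>\<close>

lemma smooth_on_wedge_family:
  fixes \<alpha> \<beta> :: "real \<Rightarrow> ('i, 'v::euclidean_space, real) dform"
  assumes S: "open S" and \<alpha>: "\<And>v. smooth_on S (\<lambda>(x, t). \<alpha> t c x v)"
      and \<beta>: "\<And>v. smooth_on S (\<lambda>(x, t). \<beta> t c x v)"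
  shows "smooth_on S (\<lambda>(x, t). wedge k l (\<alpha> t) (\<beta> t) c x v)"
  unfolding wedge_def alt_wedge_def case_prod_beta'
  by (rule smooth_on_linear_comp[OF S bounded_linear_divide],
      intro smooth_on_sum smooth_on_mult smooth_on_const S)
    (use \<alpha> \<beta> in \<open>auto simp: case_prod_beta'\<close>)

lemma vec2_nth: "vec2 a b 0 = a" "vec2 a b (Suc 0) = b" "vec2 a b 1 = b"
  by (simp_all add: vec2_def)

lemma comp_vec2: "(\<lambda>i. f (vec2 a b i)) = vec2 (f a) (f b)"
  by (auto simp: vec2_def split: nat.split)

lemma Re_Im_product_Psi:
  fixes \<eta> \<omega>1 \<omega>2 :: "real \<Rightarrow> ('i, 'v::euclidean_space, real) dform"
  assumes "alt_form 1 (\<eta> t c x)" "alt_form 2 (\<omega>1 t c x)" "alt_form 2 (\<omega>2 t c x)"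
  shows "Re_form (product_Psi \<eta> \<omega>1 \<omega>2) c (x, t) =
      plus_wedge_dt 2 (\<lambda>t. wedge 2 1 (\<omega>1 t) (\<eta> t)) (\<lambda>t c x v. (-1) * \<omega>2 t c x v) c (x, t)"
    and "Im_form (product_Psi \<eta> \<omega>1 \<omega>2) c (x, t) =
      plus_wedge_dt 2 (\<lambda>t. wedge 2 1 (\<omega>2 t) (\<eta> t)) \<omega>1 c (x, t)"
proof -
  have "alt_form 1 (on_product \<eta> c (x, t))" "alt_form 2 (on_product \<omega>1 c (x, t))"
    "alt_form 2 (on_product \<omega>2 c (x, t))"
    using assms unfolding on_product_def by (auto intro!: alt_form_compose_linear linear_fst)
  moreover have "alt_form 1 (dt c (x, t))" unfolding dt_def by (rule alt_form_1I) (rule linear_snd)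
  ultimately have cf: "alt_form 2 (complex_form (on_product \<omega>1) (on_product \<omega>2) c (x, t))"
    "alt_form 1 (complex_form (on_product \<eta>) dt c (x, t))"
    unfolding complex_form_def by (auto intro: alt_form_complex)
  have two: "\<omega> (skip i h) = \<omega> (vec2 (skip i h 0) (skip i h 1))" if "alt_form 2 \<omega>"
    for \<omega> :: "('v, real) covector" and i h
    by (rule alt_form_2_eq[OF that])
  have S: "(\<Sum>j\<le>2. f j) = f 0 + f 1 + f 2" for f :: "nat \<Rightarrow> real" by (simp add: eval_nat_numeral)
  show "Re_form (product_Psi \<eta> \<omega>1 \<omega>2) c (x, t) =
      plus_wedge_dt 2 (\<lambda>t. wedge 2 1 (\<omega>1 t) (\<eta> t)) (\<lambda>t c x v. (-1) * \<omega>2 t c x v) c (x, t)"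
    "Im_form (product_Psi \<eta> \<omega>1 \<omega>2) c (x, t) =
      plus_wedge_dt 2 (\<lambda>t. wedge 2 1 (\<omega>2 t) (\<eta> t)) \<omega>1 c (x, t)"
    unfolding Re_form_def Im_form_def product_Psi_def wedge_def plus_wedge_dt_def prod.case
      alt_wedge_2_1[OF cf] alt_wedge_2_1[OF assms(2,1)] alt_wedge_2_1[OF assms(3,1)] S
      two[OF assms(2)] two[OF assms(3)]
    by (simp_all add: fun_eq_iff complex_form_def on_product_def dt_def comp_vec2 skip_def
      algebra_simps numeral_2_eq_2)
qed

text \<open>The two mixed terms coincide because 2-forms commute, whence the factor 2, and the
  square of \<eta> \<and> dt is zero.\<close>

lemma wedge_product_F:
  fixes \<eta> \<omega>3 :: "real \<Rightarrow> ('i, 'v::euclidean_space, real) dform"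
  assumes "alt_form 1 (\<eta> t c x)" "alt_form 2 (\<omega>3 t c x)"
  shows "wedge 2 2 (product_F \<eta> \<omega>3) (product_F \<eta> \<omega>3) c (x, t) =
    plus_wedge_dt 3 (\<lambda>t. wedge 2 2 (\<omega>3 t) (\<omega>3 t)) (\<lambda>t c x v. 2 * wedge 2 1 (\<omega>3 t) (\<eta> t) c x v) c (x,
      t)"
proof -
  have forms: "alt_form 1 (on_product \<eta> c (x, t))" "alt_form 2 (on_product \<omega>3 c (x, t))"
    using assms unfolding on_product_def by (auto intro!: alt_form_compose_linear linear_fst)
  have dt: "alt_form 1 (dt c (x, t))" unfolding dt_def by (rule alt_form_1I) (rule linear_snd)
  have F: "product_F \<eta> \<omega>3 c (x, t) v = on_product \<omega>3 c (x, t) v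
    + (on_product \<eta> c (x, t) (\<lambda>_. v 0) * snd (v 1)
      - on_product \<eta> c (x, t) (\<lambda>_. v 1) * snd (v 0))" for v
    unfolding product_F_def wedge_def alt_wedge_1_1[OF forms(1) dt] by (simp add: dt_def)
  have "alt_form 2 (alt_wedge 1 1 (on_product \<eta> c (x, t)) (dt c (x, t)))"
    using alt_form_alt_wedge[OF forms(1) dt] by (simp add: numeral_2_eq_2)
  then have aF: "alt_form 2 (product_F \<eta> \<omega>3 c (x, t))"
    unfolding product_F_def wedge_def by (intro alt_form_add forms)
  have S: "(\<Sum>j\<le>3. f j) = f 0 + f 1 + f 2 + f 3" for f :: "nat \<Rightarrow> real" by (simp add: eval_nat_numeral)
  have sk: "skip 0 h 0 = h 1" "skip 0 h 1 = h 2" "skip 0 h 2 = h 3" "skip 1 h 0 = h 0"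
    "skip 1 h 1 = h 2" "skip 1 h 2 = h 3"
    "skip 2 h 0 = h 0" "skip 2 h 1 = h 1" "skip 2 h 2 = h 3" "skip 3 h 0 = h 0" "skip 3 h 1 = h 1"
      "skip 3 h 2 = h 2"
    for h :: "nat \<Rightarrow> 'v"
    by (simp_all add: skip_def eval_nat_numeral)
  show ?thesis
  proof
    fix v
    show "wedge 2 2 (product_F \<eta> \<omega>3) (product_F \<eta> \<omega>3) c (x, t) v =
      plus_wedge_dt 3 (\<lambda>t. wedge 2 2 (\<omega>3 t) (\<omega>3 t)) (\<lambda>t c x v. 2 * wedge 2 1 (\<omega>3 t) (\<eta> t) c x v) c
        (x, t) v"
      unfolding wedge_def plus_wedge_dt_def prod.case S
        alt_wedge_2_2[OF aF aF] alt_wedge_2_2[OF assms(2,2)] alt_wedge_2_1[OF assms(2,1)] F sk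
      by (simp add: on_product_def comp_vec2 vec2_nth algebra_simps)
  qed
qed

text \<open>The scalar \<open>r\<close> absorbs the constants -1, 1 and 2 with which the dt-parts of
  the three forms occur.\<close>

lemma closed_form_product_iff:
  fixes N :: "('i, 'a, 'v::euclidean_space) atlas"
  assumes N: "smooth_manifold N" and I: "open I" and k: "k = Suc m"
    and \<Gamma>: "\<And>c x t. c \<in> charts N \<Longrightarrow> x \<in> coord_range N c \<Longrightarrow> t \<in> I \<Longrightarrow>
      \<Gamma> c (x, t) = plus_wedge_dt m A (\<lambda>t c x v. r * B t c x v) c (x, t)"
    and A: "\<And>c v. c \<in> charts N \<Longrightarrow> smooth_on (coord_range N c \<times> I) (\<lambda>(x, t). A t c x v)"
    and B: "\<And>c v. c \<in> charts N \<Longrightarrow> smooth_on (coord_range N c \<times> I) (\<lambda>(x, t). B t c x v)"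
  shows "closed_form (times_interval N I) k \<Gamma> \<longleftrightarrow> (\<forall>t\<in>I. closed_form N k (A t)) \<and>
    (\<forall>t\<in>I. form_eq N (time_deriv A t) (\<lambda>c x v. - ((-1) ^ k * r) * ext_d m (B t) c x v))"
proof -
  have op: "open (coord_range N c \<times> I)" if "c \<in> charts N" for c
    using smooth_manifoldD(1)[OF N that] I by (rule open_Times)
  have dA: "(\<lambda>(x, t). A t c x w) differentiable (at (x, t))"
    and dB: "(\<lambda>(x, t). B t c x w) differentiable (at (x, t))"
    if "c \<in> charts N" "x \<in> coord_range N c" "t \<in> I" for c x t w
    using smooth_onD(1)[OF A[OF that(1)]] smooth_onD(1)[OF B[OF that(1)]] that by blast+
  have rB: "(\<lambda>(x, t). r * B t c x w) differentiable (at (x, t))"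
    if "c \<in> charts N" "x \<in> coord_range N c" "t \<in> I" for c x t w
    using differentiable_mult[OF differentiable_const[of r] dB[OF that]] by
      (simp add: case_prod_beta')
  have scale: "ext_d m (\<lambda>c x v. r * B t c x v) c x v = r * ext_d m (B t) c x v"
    if "c \<in> charts N" "x \<in> coord_range N c" "t \<in> I" for c x t v
  proof (rule ext_d_scale)
    fix w
    have "((\<lambda>y. (y, t)) has_derivative (\<lambda>h. (h, 0))) (at x)"
      by (rule has_derivative_Pair[OF has_derivative_ident has_derivative_const])
    from has_derivative_compose[OF this dB[OF that, unfolded frechet_derivative_works]]
    show "(\<lambda>y. B t c y w) differentiable (at x)"
      unfolding prod.case differentiable_def by blast
  qed
  have sgn: "a + (-1) ^ k * b = 0 \<longleftrightarrow> b = - ((-1) ^ k) * a" for a b :: real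
    by (cases "even k") auto
  have "closed_form (times_interval N I) k \<Gamma> \<longleftrightarrow> (\<forall>t\<in>I. closed_form N k (A t)) \<and>
    (\<forall>t\<in>I. \<forall>c\<in>charts N. \<forall>x\<in>coord_range N c. \<forall>h.
      ext_d m (\<lambda>c x v. r * B t c x v) c x h + (-1) ^ k * time_deriv A t c x h = 0)"
    by (rule closed_form_plus_wedge_dt_iff[OF N I k]) (fact \<Gamma> dA rB)+
  then show ?thesis
    unfolding form_eq_def fun_eq_iff sgn by (simp add: scale mult.assoc)
qed

theorem theorem3p1:
  fixes N :: "('i, 'a, real ^ 5) atlas"
    and a b :: ereal
    and I :: "real set"
    and \<eta> \<omega>1 \<omega>2 \<omega>3 :: "real \<Rightarrow> ('i, real ^ 5, real) dform"
  assumes "smooth_manifold N"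
    and "a < b" and "I = einterval a b"
    and "smooth_family N I 1 \<eta>" and "smooth_family N I 2 \<omega>1"
    and "smooth_family N I 2 \<omega>2" and "smooth_family N I 2 \<omega>3"
    and "\<And>t. t \<in> I \<Longrightarrow> SU2_structure N (\<eta> t) (\<omega>1 t) (\<omega>2 t) (\<omega>3 t)"
  shows "SU3_structure (times_interval N I) (product_F \<eta> \<omega>3) (product_Psi \<eta> \<omega>1 \<omega>2) \<and>
    (balanced_SU3_structure (times_interval N I) (product_F \<eta> \<omega>3) (product_Psi \<eta> \<omega>1 \<omega>2) \<longleftrightarrow>
      (\<forall>t\<in>I. balanced_SU2_structure N (\<eta> t) (\<omega>1 t) (\<omega>2 t) (\<omega>3 t)) \<and>
      (\<forall>t\<in>I.
         form_eq N (time_deriv (\<lambda>s. wedge 2 1 (\<omega>1 s) (\<eta> s)) t) (\<lambda>c x v. - ext_d 2 (\<omega>2 t) c x v) \<and>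
         form_eq N (time_deriv (\<lambda>s. wedge 2 1 (\<omega>2 s) (\<eta> s)) t) (ext_d 2 (\<omega>1 t)) \<and>
         form_eq N (time_deriv (\<lambda>s. wedge 2 2 (\<omega>3 s) (\<omega>3 s)) t)
           (\<lambda>c x v. - 2 * ext_d 3 (wedge 2 1 (\<omega>3 t) (\<eta> t)) c x v)))"
proof -
  note N = assms(1) and fam = assms(4-7) and SU2 = assms(8)
  have I: "open I" using assms(3) by simp
  have SU3: "SU3_structure (times_interval N I) (product_F \<eta> \<omega>3) (product_Psi \<eta> \<omega>1 \<omega>2)"
    by (rule SU3_structure_product[OF N I fam SU2])
  have op: "open (coord_range N c \<times> I)" if "c \<in> charts N" for c
    using smooth_manifoldD(1)[OF N that] I by (rule open_Times)
  have smooth: "smooth_on (coord_range N c \<times> I) (\<lambda>(x, t). \<eta> t c x v)"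
    "smooth_on (coord_range N c \<times> I) (\<lambda>(x, t). \<omega>1 t c x v)"
    "smooth_on (coord_range N c \<times> I) (\<lambda>(x, t). \<omega>2 t c x v)"
      "smooth_on (coord_range N c \<times> I) (\<lambda>(x, t). \<omega>3 t c x v)"
    if "c \<in> charts N" for c v
    using fam that unfolding smooth_family_def by blast+
  have forms: "alt_form 1 (\<eta> t c x)" "alt_form 2 (\<omega>1 t c x)" "alt_form 2 (\<omega>2 t c x)"
    "alt_form 2 (\<omega>3 t c x)"
    if "c \<in> charts N" "x \<in> coord_range N c" "t \<in> I" for c x t
    by (intro smooth_family_alt_form[OF fam(1) that] smooth_family_alt_form[OF fam(2) that]
        smooth_family_alt_form[OF fam(3) that] smooth_family_alt_form[OF fam(4) that])+
  have smooth_wedge: "smooth_on (coord_range N c \<times> I) (\<lambda>(x, t). wedge 2 1 (\<omega>1 t) (\<eta> t) c x v)"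
    "smooth_on (coord_range N c \<times> I) (\<lambda>(x, t). wedge 2 1 (\<omega>2 t) (\<eta> t) c x v)"
    "smooth_on (coord_range N c \<times> I) (\<lambda>(x, t). wedge 2 1 (\<omega>3 t) (\<eta> t) c x v)"
    "smooth_on (coord_range N c \<times> I) (\<lambda>(x, t). wedge 2 2 (\<omega>3 t) (\<omega>3 t) c x v)"
    if "c \<in> charts N" for c v
    by (rule smooth_on_wedge_family[OF op[OF that]]; rule smooth[OF that])+
  let ?M = "times_interval N I" and ?F = "product_F \<eta> \<omega>3" and ?\<Psi> = "product_Psi \<eta> \<omega>1 \<omega>2"
  \<comment> \<open>Here \<open>k = 3\<close> and \<open>r = -1\<close>, which gives the coefficient
    -1; the next two cases have \<open>k = 3, r = 1\<close> and \<open>k = 4, r = 2\<close>, with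
    coefficients 1 and -2.\<close>
  have "closed_form ?M 3 (Re_form ?\<Psi>) \<longleftrightarrow> (\<forall>t\<in>I. closed_form N 3 (wedge 2 1 (\<omega>1 t) (\<eta> t))) \<and>
    (\<forall>t\<in>I. form_eq N (time_deriv (\<lambda>s. wedge 2 1 (\<omega>1 s) (\<eta> s)) t) (\<lambda>c x v.
      - ((-1) ^ 3 * (-1)) * ext_d 2 (\<omega>2 t) c x v))"
    by (rule closed_form_product_iff[OF N I])
      (simp, rule Re_Im_product_Psi(1)[OF forms(1-3)], assumption+, erule smooth_wedge(1), erule
        smooth(3))
  moreover have "closed_form ?M 3 (Im_form ?\<Psi>) \<longleftrightarrow> (\<forall>t\<in>I. closed_form N 3 (wedge 2 1 (\<omega>2 t) (\<eta> t))) \<and>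
    (\<forall>t\<in>I. form_eq N (time_deriv (\<lambda>s. wedge 2 1 (\<omega>2 s) (\<eta> s)) t) (\<lambda>c x v.
      - ((-1) ^ 3 * 1) * ext_d 2 (\<omega>1 t) c x v))"
    by (rule closed_form_product_iff[OF N I])
      (simp, simp only: mult_1, rule Re_Im_product_Psi(2)[OF forms(1-3)], assumption+, erule
        smooth_wedge(2), erule smooth(2))
  moreover have "closed_form ?M 4 (wedge 2 2 ?F ?F) \<longleftrightarrow> (\<forall>t\<in>I. closed_form N 4 (wedge 2 2 (\<omega>3 t) (\<omega>3
    t))) \<and>
    (\<forall>t\<in>I. form_eq N (time_deriv (\<lambda>s. wedge 2 2 (\<omega>3 s) (\<omega>3 s)) t)
      (\<lambda>c x v. - ((-1) ^ 4 * 2) * ext_d 3 (wedge 2 1 (\<omega>3 t) (\<eta> t)) c x v))"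
    by (rule closed_form_product_iff[OF N I])
      (simp, rule wedge_product_F[OF forms(1,4)], assumption+, erule smooth_wedge(4), erule
        smooth_wedge(3))
  \<comment> \<open>The structure conjuncts in both notions of balancedness hold by
    \<open>SU3\<close> and \<open>SU2\<close>, so only the closedness conditions have to be
    matched.\<close>
  ultimately show ?thesis
    using SU3 SU2 unfolding balanced_SU3_structure_def balanced_SU2_structure_def by simp blast
qed

end
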